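(* There exists a constant $C>0$ such that $$|G_4(x,t)|\le C(1+|t|)^{-3/2}\log(2+|t|)\qquad\text{for all }(x,t)\in\mathbb Z^4\times\mathbb R.$$
   Context: $G_4$ is the fundamental solution of the discrete wave equation on $\mathbb Z^4$. Explicitly, for $(x,t)\in\mathbb Z^4\times\mathbb R$, $$G_4(x,t)=\frac1{(2\pi)^4}\int_{\mathbb T^4}e^{ix\cdot\xi}\,\frac{\sin(t\omega(\xi))}{\omega(\xi)}\,d\xi,\qquad \omega(\xi)=\Big(\sum_{j=1}^4(2-2\cos\xi_j)\Big)^{1/2},$$ where $\mathbb T^4$ is the cube $[-\pi,\pi]^4$ with opposite sides identified, with Lebesgue measure. *)

theory Defs
  imports "HOL-Analysis.Analysis"
begin

definition omega :: "real ^ 4 \<Rightarrow> real" where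
  "omega \<xi> = sqrt (\<Sum>j\<in>UNIV. 2 - 2 * cos (\<xi> $ j))"

text \<open>
  Opposite sides of the cube need not be identified for integration, since its faces are null sets.
  On the cube, \<open>omega\<close> vanishes only at the origin, where the quotient below takes the value 0 by
  convention instead of its limit \<open>t\<close>. This is also a null set.
\<close>

definition torus4 :: "(real ^ 4) set" where
  "torus4 = cbox (\<chi> j. - pi) (\<chi> j. pi)"

definition G4 :: "int ^ 4 \<Rightarrow> real \<Rightarrow> complex" where
  "G4 x t = 1 / (2 * complex_of_real pi) ^ 4 *
     (LINT \<xi>:torus4|lborel.
        exp (\<i> * complex_of_real (\<Sum>j\<in>UNIV. real_of_int (x $ j) * \<xi> $ j)) *
        complex_of_real (sin (t * omega \<xi>) / omega \<xi>))"

end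

theory Submission imports Defs begin

text \<open>
  The wave propagator is a superposition of Schroedinger propagators: for \<open>\<lambda>, t > 0\<close>, completing the
  square and substituting \<open>u = r - c / r\<close> with \<open>c = t / (2 \<surd>\<lambda>)\<close> shows that
  \<open>\<integral>\<^sub>0\<^sup>R exp (i\<lambda>r\<^sup>2 + it\<^sup>2/(4r\<^sup>2)) dr\<close> tends to \<open>\<kappa> exp (it\<surd>\<lambda>) / \<surd>\<lambda>\<close>, where \<open>\<kappa> \<noteq> 0\<close> is the Fresnel integral.
  With \<open>\<lambda> = \<omega>(\<xi>)\<^sup>2\<close> the Schroedinger kernel on \<open>\<int>\<^sup>4\<close> at time \<open>s = r\<^sup>2\<close> is a product of four Bessel functions of
  argument \<open>2s\<close>, and van der Corput's method gives \<open>s \<bar>J\<^sub>n(2s)\<bar>\<^sup>4 \<le> C / (1 + \<bar>2s - \<bar>n\<bar>\<bar>)\<close> uniformly in \<open>n\<close>.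
  For \<open>r \<ge> \<surd>t\<close> this bound is integrated in absolute value; the singularity at \<open>2s = \<bar>n\<bar>\<close> produces the
  logarithm. For \<open>r \<le> \<surd>t\<close> the factor \<open>exp (it\<^sup>2/(4r\<^sup>2))\<close> oscillates faster than the spectrum of the Laplacian
  allows the kernel to, and one integration by parts suffices.
\<close>

section \<open>Van der Corput estimates\<close>

text \<open>The Hessian of omega loses rank in several ways on the torus, so a direct stationary
  phase analysis in four variables would have to treat many cases. Since omega^2 is a sum over
  coordinates, passing to it leaves one-dimensional phases with at worst a cubic degeneracy. The
  fourth power is matched to the dimension: a product of four kernels is at most the sum of their
  fourth powers, so the coordinates of x decouple and every bound is uniform in x. The exponent is
  scaling. Beyond sqrt t the integrand is at most r^(-2) times weights in s = r^2; writing dr = ds /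
  (2 r) leaves r^(-3), hence t^(-3/2), while the weights integrate in s to a logarithm. Near 0 the
  factor r^(-2) is not integrable; the integration by parts repairs this with a weight r^3 / t^2,
  and the derivative of the kernel decays like the kernel because it combines neighbouring ones. The
  integral over r converges only conditionally, so everything is done on [0, R] with bounds free of
  R. The limit is taken under the torus integral, dominated by a multiple of 1 / omega.\<close>

lemma cis_has_vector_derivative:
  assumes "(\<psi> has_real_derivative d) (at x within S)"
  shows "((\<lambda>x. cis (\<psi> x)) has_vector_derivative \<i> * of_real d * cis (\<psi> x)) (at x within S)"
proof -
  have "((\<lambda>x. Complex (cos (\<psi> x)) (sin (\<psi> x))) has_vector_derivative
      Complex (- sin (\<psi> x) * d) (cos (\<psi> x) * d)) (at x within S)"
    unfolding has_vector_derivative_complex_iff using assms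
    by (auto intro!: derivative_eq_intros)
  moreover have "Complex (- sin (\<psi> x) * d) (cos (\<psi> x) * d) = \<i> * of_real d * cis (\<psi> x)"
    by (simp add: complex_eq_iff)
  ultimately show ?thesis by (simp add: cis.ctr)
qed

text \<open>Integration by parts against \<open>1 / \<psi>'\<close>. Convexity makes
  \<open>1 / \<psi>'\<close> monotone, so its variation telescopes to
  \<open>1 / \<psi>' a - 1 / \<psi>' b\<close>; together with the two boundary terms this is
  \<open>2 / \<psi>' a\<close>.\<close>

lemma van_der_corput_increasing:
  fixes \<psi> \<psi>' \<psi>'' :: "real \<Rightarrow> real"
  assumes ab: "a \<le> b" and m: "0 < m"
    and d1: "\<And>x. x \<in> {a..b} \<Longrightarrow> (\<psi> has_real_derivative \<psi>' x) (at x)"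
    and d2: "\<And>x. x \<in> {a..b} \<Longrightarrow> (\<psi>' has_real_derivative \<psi>'' x) (at x)"
    and c2: "continuous_on {a..b} \<psi>''"
    and pos: "\<And>x. x \<in> {a..b} \<Longrightarrow> 0 \<le> \<psi>'' x"
    and low: "\<And>x. x \<in> {a..b} \<Longrightarrow> m \<le> \<psi>' x"
  shows "cmod (integral {a..b} (\<lambda>x. cis (\<psi> x))) \<le> 2 / m"
proof -
  define U where "U x = cis (\<psi> x) * of_real (1 / \<psi>' x)" for x
  define q where "q x = \<psi>'' x / (\<psi>' x)\<^sup>2" for x
  have nz: "\<psi>' x \<noteq> 0" if "x \<in> {a..b}" for x using low[OF that] m by auto
  have c0: "continuous_on {a..b} \<psi>" using d1 by (meson DERIV_isCont continuous_at_imp_continuous_on)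
  have c1: "continuous_on {a..b} \<psi>'" using d2 by (meson DERIV_isCont continuous_at_imp_continuous_on)
  have cq: "continuous_on {a..b} q" unfolding q_def
    by (intro continuous_intros c1 c2) (use nz in auto)
  have ccis: "continuous_on {a..b} (\<lambda>x. cis (\<psi> x))"
    using continuous_on_cis c0 by blast
  have dinv: "((\<lambda>x. 1 / \<psi>' x) has_real_derivative - q x) (at x within {a..b})" if "x \<in> {a..b}" for x
    unfolding q_def using has_field_derivative_at_within[OF d2[OF that]] nz[OF that]
    by (auto intro!: derivative_eq_intros simp: power2_eq_square)
  have dU: "(U has_vector_derivative (\<i> * cis (\<psi> x) - of_real (q x) * cis (\<psi> x))) (at x within {a..b})"
    if x: "x \<in> {a..b}" for x
  proof -
    have "((\<lambda>x. of_real (1 / \<psi>' x) :: complex) has_vector_derivative of_real (- q x)) (at x within {a..b})"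
      using dinv[OF x] by (intro has_vector_derivative_of_real) (simp add: has_real_derivative_iff_has_vector_derivative)
    from has_vector_derivative_mult[OF cis_has_vector_derivative[OF has_field_derivative_at_within[OF d1[OF x]]] this]
    show ?thesis unfolding U_def using nz[OF x] by (simp add: algebra_simps)
  qed
  have "((\<lambda>x. \<i> * cis (\<psi> x) - of_real (q x) * cis (\<psi> x)) has_integral (U b - U a)) {a..b}"
    using fundamental_theorem_of_calculus[OF ab dU] by blast
  moreover have i1: "(\<lambda>x. of_real (q x) * cis (\<psi> x)) integrable_on {a..b}"
    by (intro integrable_continuous_real continuous_intros cq ccis)
  ultimately have "((\<lambda>x. (\<i> * cis (\<psi> x) - of_real (q x) * cis (\<psi> x)) + of_real (q x) * cis (\<psi> x)) has_integral
      (U b - U a) + integral {a..b} (\<lambda>x. of_real (q x) * cis (\<psi> x))) {a..b}"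
    by (intro has_integral_add) (auto simp: has_integral_integral)
  hence "((\<lambda>x. \<i> * cis (\<psi> x)) has_integral
      (U b - U a) + integral {a..b} (\<lambda>x. of_real (q x) * cis (\<psi> x))) {a..b}" by simp
  hence "\<i> * integral {a..b} (\<lambda>x. cis (\<psi> x)) = (U b - U a) + integral {a..b} (\<lambda>x. of_real (q x) * cis (\<psi> x))"
    by (metis integral_mult_right integral_unique)
  hence "cmod (integral {a..b} (\<lambda>x. cis (\<psi> x))) = cmod ((U b - U a) + integral {a..b} (\<lambda>x. of_real (q x) * cis (\<psi> x)))"
    by (metis mult_1 norm_ii norm_mult)
  also have "\<dots> \<le> cmod (U b) + cmod (U a) + cmod (integral {a..b} (\<lambda>x. of_real (q x) * cis (\<psi> x)))"
    by (meson add_mono norm_triangle_ineq norm_triangle_ineq4 order_refl order_trans)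
  also have "cmod (integral {a..b} (\<lambda>x. of_real (q x) * cis (\<psi> x))) \<le> integral {a..b} q"
  proof (rule integral_norm_bound_integral[OF i1])
    show "q integrable_on {a..b}" using cq by (rule integrable_continuous_real)
    fix x assume x: "x \<in> {a..b}"
    show "cmod (of_real (q x) * cis (\<psi> x)) \<le> q x"
      using pos[OF x] by (simp add: norm_mult norm_divide norm_power q_def)
  qed
  also have "integral {a..b} q = 1 / \<psi>' a - 1 / \<psi>' b"
  proof -
    have "((\<lambda>x. - (1 / \<psi>' x)) has_vector_derivative q x) (at x within {a..b})" if "x \<in> {a..b}" for x
      using DERIV_minus[OF dinv[OF that]] by (simp add: has_real_derivative_iff_has_vector_derivative)
    from fundamental_theorem_of_calculus[OF ab this] show ?thesis
      by (simp add: integral_unique)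
  qed
  also have "cmod (U b) = 1 / \<psi>' b" unfolding U_def using low[of b] ab m by (simp add: norm_mult norm_divide)
  also have "cmod (U a) = 1 / \<psi>' a" unfolding U_def using low[of a] ab m by (simp add: norm_mult norm_divide)
  finally have "cmod (integral {a..b} (\<lambda>x. cis (\<psi> x))) \<le> 2 / \<psi>' a" by simp
  also have "\<dots> \<le> 2 / m" using low[of a] ab m by (simp add: frac_le)
  finally show ?thesis .
qed

lemma van_der_corput_decreasing:
  fixes \<psi> \<psi>' \<psi>'' :: "real \<Rightarrow> real"
  assumes ab: "a \<le> b" and m: "0 < m"
    and d1: "\<And>x. x \<in> {a..b} \<Longrightarrow> (\<psi> has_real_derivative \<psi>' x) (at x)"
    and d2: "\<And>x. x \<in> {a..b} \<Longrightarrow> (\<psi>' has_real_derivative \<psi>'' x) (at x)"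
    and c2: "continuous_on {a..b} \<psi>''"
    and pos: "\<And>x. x \<in> {a..b} \<Longrightarrow> 0 \<le> \<psi>'' x"
    and upp: "\<And>x. x \<in> {a..b} \<Longrightarrow> \<psi>' x \<le> - m"
  shows "cmod (integral {a..b} (\<lambda>x. cis (\<psi> x))) \<le> 2 / m"
proof -
  have "cmod (integral {-b..-a} (\<lambda>x. cis ((\<lambda>x. \<psi> (-x)) x))) \<le> 2 / m"
  proof (rule van_der_corput_increasing[where \<psi>' = "\<lambda>x. - \<psi>' (-x)" and \<psi>'' = "\<lambda>x. \<psi>'' (-x)"])
    show "-b \<le> -a" "0 < m" using ab m by auto
    fix x assume x: "x \<in> {-b..-a}"
    hence x': "-x \<in> {a..b}" by auto
    have "((\<lambda>x. \<psi> (-x)) has_real_derivative \<psi>' (-x) * - 1) (at x)"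
      by (rule DERIV_chain2[where f = \<psi> and g = uminus, OF d1[OF x']]) (auto intro!: derivative_eq_intros)
    thus "((\<lambda>x. \<psi> (-x)) has_real_derivative - \<psi>' (-x)) (at x)" by simp
    have "((\<lambda>x. - \<psi>' (-x)) has_real_derivative - (\<psi>'' (-x) * - 1)) (at x)"
      by (rule DERIV_minus[OF DERIV_chain2[where f = "\<psi>'" and g = uminus, OF d2[OF x']]]) (auto intro!: derivative_eq_intros)
    thus "((\<lambda>x. - \<psi>' (-x)) has_real_derivative \<psi>'' (-x)) (at x)" by simp
    show "0 \<le> \<psi>'' (-x)" "m \<le> - \<psi>' (-x)" using pos[OF x'] upp[OF x'] by auto
  next
    show "continuous_on {-b..-a} (\<lambda>x. \<psi>'' (-x))"
      by (intro continuous_on_compose2[OF c2] continuous_intros) auto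
  qed
  thus ?thesis by (simp add: Henstock_Kurzweil_Integration.integral_reflect_real[where f = "\<lambda>x. cis (\<psi> x)"])
qed

text \<open>A monotone function has an interval as its sublevel set of \<open>\<bar>g\<bar>\<close>.
  The equalities in the disjunctions cover absent pieces: such a piece is a single point, at which
  its inequality may fail.\<close>

lemma mono_split:
  fixes g :: "real \<Rightarrow> real"
  assumes ab: "a \<le> b" and m: "0 < m" and c: "continuous_on {a..b} g"
    and mono: "\<And>x y. a \<le> x \<Longrightarrow> x \<le> y \<Longrightarrow> y \<le> b \<Longrightarrow> g x \<le> g y"
  obtains \<alpha> \<beta> where "a \<le> \<alpha>" "\<alpha> \<le> \<beta>" "\<beta> \<le> b"
    "\<alpha> = a \<or> (\<forall>x\<in>{a..\<alpha>}. g x \<le> - m)" "\<beta> = b \<or> (\<forall>x\<in>{\<beta>..b}. m \<le> g x)"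
    "\<alpha> = \<beta> \<or> (\<forall>x\<in>{\<alpha>..\<beta>}. \<bar>g x\<bar> \<le> m)"
proof -
  consider "m \<le> g a" | "g b \<le> - m" | "g a < m" "- m < g b" by linarith
  thus ?thesis
  proof cases
    case 1
    show ?thesis
      by (rule that[of a a]) (use 1 ab mono in \<open>fastforce+\<close>)
  next
    case 2
    show ?thesis
      by (rule that[of b b]) (use 2 ab mono in \<open>fastforce+\<close>)
  next
    case 3
    obtain \<alpha> where \<alpha>: "a \<le> \<alpha>" "\<alpha> \<le> b" "- m \<le> g \<alpha>" "g \<alpha> < m" "\<alpha> = a \<or> g \<alpha> = - m"
    proof (cases "g a < - m")
      case True
      then obtain x where "a \<le> x" "x \<le> b" "g x = - m"
        using IVT'[of g a "-m" b] 3 c ab by auto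
      thus ?thesis using that[of x] m by auto
    next
      case False thus ?thesis using that[of a] 3 ab by auto
    qed
    obtain \<beta> where \<beta>: "\<alpha> \<le> \<beta>" "\<beta> \<le> b" "g \<beta> \<le> m" "\<beta> = b \<or> g \<beta> = m"
    proof (cases "g b > m")
      case True
      then obtain x where "\<alpha> \<le> x" "x \<le> b" "g x = m"
        using IVT'[of g \<alpha> m b] \<alpha> continuous_on_subset[OF c, of "{\<alpha>..b}"] by auto
      thus ?thesis using that[of x] m by auto
    next
      case False thus ?thesis using that[of b] \<alpha> by auto
    qed
    show ?thesis
    proof (rule that[of \<alpha> \<beta>])
      show "\<alpha> = a \<or> (\<forall>x\<in>{a..\<alpha>}. g x \<le> - m)" using \<alpha> mono[of _ \<alpha>] by force
      show "\<beta> = b \<or> (\<forall>x\<in>{\<beta>..b}. m \<le> g x)" using \<alpha> \<beta> mono[of \<beta>] by force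
      have "\<bar>g x\<bar> \<le> m" if "x \<in> {\<alpha>..\<beta>}" for x
        using mono[of \<alpha> x] mono[of x \<beta>] \<alpha> \<beta> that by auto
      thus "\<alpha> = \<beta> \<or> (\<forall>x\<in>{\<alpha>..\<beta>}. \<bar>g x\<bar> \<le> m)" by blast
    qed (use \<alpha> \<beta> in auto)
  qed
qed

lemma van_der_corput_sublevel:
  fixes \<psi> \<psi>' \<psi>'' :: "real \<Rightarrow> real"
  assumes ab: "a \<le> b" and m: "0 < m"
    and d1: "\<And>x. x \<in> {a..b} \<Longrightarrow> (\<psi> has_real_derivative \<psi>' x) (at x)"
    and d2: "\<And>x. x \<in> {a..b} \<Longrightarrow> (\<psi>' has_real_derivative \<psi>'' x) (at x)"
    and c2: "continuous_on {a..b} \<psi>''"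
    and pos: "\<And>x. x \<in> {a..b} \<Longrightarrow> 0 \<le> \<psi>'' x"
    and l: "0 \<le> l"
    and sub: "\<And>\<alpha> \<beta>. a \<le> \<alpha> \<Longrightarrow> \<alpha> < \<beta> \<Longrightarrow> \<beta> \<le> b \<Longrightarrow> \<forall>x\<in>{\<alpha>..\<beta>}. \<bar>\<psi>' x\<bar> \<le> m \<Longrightarrow> \<beta> - \<alpha> \<le> l"
  shows "cmod (integral {a..b} (\<lambda>x. cis (\<psi> x))) \<le> l + 4 / m"
proof -
  have c0: "continuous_on {a..b} \<psi>" using d1 by (meson DERIV_isCont continuous_at_imp_continuous_on)
  have c1: "continuous_on {a..b} \<psi>'" using d2 by (meson DERIV_isCont continuous_at_imp_continuous_on)
  have mono: "\<psi>' x \<le> \<psi>' y" if "a \<le> x" "x \<le> y" "y \<le> b" for x y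
  proof (rule DERIV_nonneg_imp_nondecreasing[OF that(2)])
    fix z assume "x \<le> z" "z \<le> y"
    hence "z \<in> {a..b}" using that by auto
    thus "\<exists>w. (\<psi>' has_real_derivative w) (at z) \<and> 0 \<le> w" using d2 pos by blast
  qed
  obtain \<alpha> \<beta> where *: "a \<le> \<alpha>" "\<alpha> \<le> \<beta>" "\<beta> \<le> b"
    "\<alpha> = a \<or> (\<forall>x\<in>{a..\<alpha>}. \<psi>' x \<le> - m)" "\<beta> = b \<or> (\<forall>x\<in>{\<beta>..b}. m \<le> \<psi>' x)"
    "\<alpha> = \<beta> \<or> (\<forall>x\<in>{\<alpha>..\<beta>}. \<bar>\<psi>' x\<bar> \<le> m)"
    using mono_split[OF ab m c1 mono] by blast
  define f where "f x = cis (\<psi> x)" for x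
  have cf: "continuous_on {a..b} f" unfolding f_def using continuous_on_cis c0 by blast
  have intf: "f integrable_on {x..y}" if "a \<le> x" "y \<le> b" for x y
    by (rule integrable_continuous_real, rule continuous_on_subset[OF cf]) (use that in auto)
  have "integral {a..b} f = integral {a..\<alpha>} f + integral {\<alpha>..\<beta>} f + integral {\<beta>..b} f"
    using Henstock_Kurzweil_Integration.integral_combine[of a \<beta> b f]
      Henstock_Kurzweil_Integration.integral_combine[of a \<alpha> \<beta> f] * intf by auto
  also have "cmod \<dots> \<le> 2 / m + l + 2 / m"
  proof (intro order_trans[OF norm_triangle_ineq] add_mono)
    show "cmod (integral {a..\<alpha>} f) \<le> 2 / m"
    proof (cases "\<alpha> = a")
      case False
      show ?thesis unfolding f_def
        apply (rule van_der_corput_decreasing[OF *(1) m, where \<psi>' = \<psi>' and \<psi>'' = \<psi>''])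
        using * False pos continuous_on_subset[OF c2, of "{a..\<alpha>}"]
          d1 d2 by auto
    qed (use m in auto)
    show "cmod (integral {\<beta>..b} f) \<le> 2 / m"
    proof (cases "\<beta> = b")
      case False
      show ?thesis unfolding f_def
        apply (rule van_der_corput_increasing[OF *(3) m, where \<psi>' = \<psi>' and \<psi>'' = \<psi>''])
        using * False pos continuous_on_subset[OF c2, of "{\<beta>..b}"]
          d1 d2 by auto
    qed (use m in auto)
    show "cmod (integral {\<alpha>..\<beta>} f) \<le> l"
    proof (cases "\<alpha> = \<beta>")
      case False
      have "cmod (integral {\<alpha>..\<beta>} f) \<le> 1 * (\<beta> - \<alpha>)"
        by (rule integral_bound) (use * continuous_on_subset[OF cf, of "{\<alpha>..\<beta>}"] in \<open>auto simp: f_def\<close>)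
      also have "\<dots> \<le> l" using sub[of \<alpha> \<beta>] * False by auto
      finally show ?thesis .
    qed (use l in auto)
  qed
  finally show ?thesis unfolding f_def by simp
qed

section \<open>Bessel integrals\<close>

text \<open>Taylor's bound gives sin x >= x (1 - x^2 / 6), and x < 2 turns the bracket into at least
  1/3.\<close>

lemma sin_ge_third:
  assumes "0 \<le> x" "x \<le> pi / 2"
  shows "x / 3 \<le> sin (x::real)"
proof -
  have "\<bar>sin x - (\<Sum>m<3. sin_coeff m * x ^ m)\<bar> \<le> inverse (fact 3) * \<bar>x\<bar> ^ 3"
    by (rule Maclaurin_sin_bound)
  hence "\<bar>sin x - x\<bar> \<le> x * x\<^sup>2 / 6"
    using assms by (simp add: sin_coeff_def eval_nat_numeral fact_numeral)
  hence "x - sin x \<le> x * x\<^sup>2 / 6" by linarith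
  also have "x\<^sup>2 \<le> 2\<^sup>2" using assms pi_half_less_two by (intro power_mono) linarith+
  hence "x * x\<^sup>2 / 6 \<le> x * 4 / 6" using assms by (intro divide_right_mono mult_left_mono) auto
  finally show ?thesis by simp
qed

lemma bessel_phase_derivs:
  fixes n z x :: real
  shows "((\<lambda>x. n * x - z * cos x) has_real_derivative n + z * sin x) (at x)"
    and "((\<lambda>x. n + z * sin x) has_real_derivative z * cos x) (at x)"
  by (auto intro!: derivative_eq_intros)

text \<open>On this half period the phase is convex whatever \<open>n\<close> is. Its second
  derivative vanishes only at the ends, to first order, so a sublevel interval of half-length
  \<delta> forces z \<delta>^2 to be at most of order m. With \<open>z = m ^ 3\<close> this makes
  \<delta> of order 1 / m, the size of the other contributions.\<close>

lemma bessel_phase_integral_degenerate: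
  fixes n z m :: real
  assumes ab: "- (pi / 2) \<le> a" "a \<le> b" "b \<le> pi / 2" and m: "0 < m" and z: "z = m ^ 3"
  shows "cmod (integral {a..b} (\<lambda>x. cis (n * x - z * cos x))) \<le> 10 / m"
proof -
  have "cmod (integral {a..b} (\<lambda>x. cis (n * x - z * cos x))) \<le> 6 / m + 4 / m"
  proof (rule van_der_corput_sublevel[OF ab(2) m bessel_phase_derivs])
    show "continuous_on {a..b} (\<lambda>x. z * cos x)" by (intro continuous_intros)
    show "0 \<le> z * cos x" if "x \<in> {a..b}" for x
      using that ab m by (auto simp: z intro!: mult_nonneg_nonneg cos_ge_zero)
    show "0 \<le> 6 / m" using m by simp
    fix \<alpha> \<beta> assume h: "a \<le> \<alpha>" "\<alpha> < \<beta>" "\<beta> \<le> b" "\<forall>x\<in>{\<alpha>..\<beta>}. \<bar>n + z * sin x\<bar> \<le> m"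
    define \<delta> where "\<delta> = (\<beta> - \<alpha>) / 2"
    have \<delta>: "0 \<le> \<delta>" "\<delta> \<le> pi / 2" using h ab by (auto simp: \<delta>_def)
    have s: "\<delta> / 3 \<le> sin \<delta>" using sin_ge_third \<delta> by blast
    \<comment> \<open>The midpoint keeps distance \<delta> from both degenerate points, so its
      cosine is at least sin \<delta>.\<close>
    have u: "\<bar>(\<beta> + \<alpha>) / 2\<bar> \<le> pi / 2 - \<delta>" using h ab unfolding \<delta>_def by (simp add: abs_le_iff field_simps)
    have "cos (pi / 2 - \<delta>) \<le> cos \<bar>(\<beta> + \<alpha>) / 2\<bar>"
      using u \<delta> by (intro cos_monotone_0_pi_le) auto
    hence c: "\<delta> / 3 \<le> cos ((\<beta> + \<alpha>) / 2)" using s unfolding cos_abs_real by (simp add: cos_diff)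
    have "n + z * sin \<beta> \<le> m" "- m \<le> n + z * sin \<alpha>"
      using h(2,4) by (auto simp: abs_le_iff dest: bspec[of _ _ \<alpha>] bspec[of _ _ \<beta>])
    hence "z * (sin \<beta> - sin \<alpha>) \<le> 2 * m" by (simp add: algebra_simps)
    moreover have "sin \<beta> - sin \<alpha> = 2 * (sin \<delta> * cos ((\<beta> + \<alpha>) / 2))"
      by (simp add: sin_diff_sin \<delta>_def)
    moreover have "(\<delta> / 3) * (\<delta> / 3) \<le> sin \<delta> * cos ((\<beta> + \<alpha>) / 2)"
      using s c \<delta> by (intro mult_mono) auto
    ultimately have "z * (2 * ((\<delta> / 3) * (\<delta> / 3))) \<le> 2 * m"
      using m z by (smt (verit) mult_left_mono zero_less_power)
    hence "m * (m * \<delta>)\<^sup>2 \<le> m * 9" unfolding z by (simp add: power2_eq_square power3_eq_cube algebra_simps)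
    hence "(m * \<delta>)\<^sup>2 \<le> 3\<^sup>2" using m by simp
    hence "m * \<delta> \<le> 3" by (rule power2_le_imp_le) simp
    thus "\<beta> - \<alpha> \<le> 6 / m" using m unfolding \<delta>_def by (simp add: field_simps)
  qed
  thus ?thesis by simp
qed

text \<open>Near a stationary point z |sin x| is close to |n|, so it stays away from z when |n|
  does. This bounds \<open>z * cos x\<close> from below by a multiple of \<open>m\<^sup>2\<close> on
  the sublevel set, and the mean value theorem bounds the length of that set.\<close>

lemma bessel_phase_integral_nondegenerate:
  fixes n z m :: real
  assumes ab: "- (pi / 2) \<le> a" "a \<le> b" "b \<le> pi / 2" and m: "0 < m" and z: "0 < z"
    and m4: "m ^ 4 = z * \<bar>z - \<bar>n\<bar>\<bar>" and m2: "2 * m \<le> \<bar>z - \<bar>n\<bar>\<bar>"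
  shows "cmod (integral {a..b} (\<lambda>x. cis (n * x - z * cos x))) \<le> 10 / m"
proof -
  have "cmod (integral {a..b} (\<lambda>x. cis (n * x - z * cos x))) \<le> 4 / m + 4 / m"
  proof (rule van_der_corput_sublevel[OF ab(2) m bessel_phase_derivs])
    show "continuous_on {a..b} (\<lambda>x. z * cos x)" by (intro continuous_intros)
    show "0 \<le> z * cos x" if "x \<in> {a..b}" for x
      using that ab z by (auto intro!: mult_nonneg_nonneg cos_ge_zero)
    show "0 \<le> 4 / m" using m by simp
    fix \<alpha> \<beta> assume h: "a \<le> \<alpha>" "\<alpha> < \<beta>" "\<beta> \<le> b" "\<forall>x\<in>{\<alpha>..\<beta>}. \<bar>n + z * sin x\<bar> \<le> m"
    define D where "D = \<bar>z - \<bar>n\<bar>\<bar>"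
    have low: "m\<^sup>2 / 2 \<le> z * cos x" if x: "x \<in> {\<alpha>..\<beta>}" for x
    proof -
      have e: "\<bar>n + z * sin x\<bar> \<le> m" using h(4) x by blast
      have zs: "\<bar>z * sin x\<bar> = z * \<bar>sin x\<bar>" using z by (simp add: abs_mult)
      have s1: "z * \<bar>sin x\<bar> \<le> z" using z by simp
      \<comment> \<open>For |n| >= z the first derivative is at least D >= 2 m in modulus, so the
        sublevel set is empty.\<close>
      have "\<bar>n\<bar> < z"
      proof (rule ccontr)
        assume "\<not> \<bar>n\<bar> < z"
        hence "\<bar>n\<bar> = z + D" by (simp add: D_def)
        thus False using e s1 zs m2 m D_def by linarith
      qed
      hence "\<bar>n\<bar> = z - D" by (simp add: D_def)
      hence "z * \<bar>sin x\<bar> \<le> z - D / 2" using e zs m2 D_def by linarith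
      hence "D / 2 \<le> z * (1 - \<bar>sin x\<bar>)" by (simp add: algebra_simps)
      hence "z * (D / 2) \<le> z * (z * (1 - \<bar>sin x\<bar>))" using z by (intro mult_left_mono) auto
      also have "(sin x)\<^sup>2 \<le> \<bar>sin x\<bar>"
        using mult_left_mono[of "\<bar>sin x\<bar>" 1 "\<bar>sin x\<bar>"] by (simp add: power2_eq_square)
      hence "z * (z * (1 - \<bar>sin x\<bar>)) \<le> z * (z * (1 - (sin x)\<^sup>2))" using z by simp
      also have "\<dots> = (z * cos x)\<^sup>2" by (simp add: power2_eq_square cos_squared_eq[unfolded power2_eq_square])
      finally have "m ^ 4 / 2 \<le> (z * cos x)\<^sup>2" using m4 D_def by simp
      \<comment> \<open>A factor 2 is given away here to avoid a square root of 2 in the lower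
        bound.\<close>
      moreover have "(m\<^sup>2 / 2)\<^sup>2 \<le> m ^ 4 / 2" by (simp add: power_divide)
      ultimately have "(m\<^sup>2 / 2)\<^sup>2 \<le> (z * cos x)\<^sup>2" by linarith
      moreover have "0 \<le> z * cos x" using x h ab z by (auto intro!: mult_nonneg_nonneg cos_ge_zero)
      ultimately show ?thesis by (rule power2_le_imp_le)
    qed
    obtain w where w: "\<alpha> < w" "w < \<beta>" "(n + z * sin \<beta>) - (n + z * sin \<alpha>) = (\<beta> - \<alpha>) * (z * cos w)"
      using MVT2[OF h(2) bessel_phase_derivs(2)] by blast
    have "n + z * sin \<beta> \<le> m" "- m \<le> n + z * sin \<alpha>"
      using h(2,4) by (auto simp: abs_le_iff dest: bspec[of _ _ \<alpha>] bspec[of _ _ \<beta>])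
    hence "(\<beta> - \<alpha>) * (z * cos w) \<le> 2 * m" using w by linarith
    moreover have "(\<beta> - \<alpha>) * (m\<^sup>2 / 2) \<le> (\<beta> - \<alpha>) * (z * cos w)"
      using low[of w] w h by (intro mult_left_mono) auto
    ultimately have "(\<beta> - \<alpha>) * (m\<^sup>2 / 2) \<le> 2 * m" by linarith
    hence "m * ((\<beta> - \<alpha>) * m) \<le> m * 4" by (simp add: power2_eq_square algebra_simps)
    hence "(\<beta> - \<alpha>) * m \<le> 4" using m by (rule mult_left_le_imp_le)
    thus "\<beta> - \<alpha> \<le> 4 / m" using m by (simp add: field_simps)
  qed
  also have "\<dots> \<le> 10 / m" using m by (simp add: field_simps)
  finally show ?thesis .
qed

text \<open>The two summands of \<open>1 + \<bar>z - \<bar>n\<bar>\<bar>\<close> are treated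
  separately: \<open>A\<close> contributes 10000 and \<open>B\<close> contributes 30000.\<close>

lemma bessel_phase_integral_quartic:
  fixes n z :: real
  assumes ab: "- (pi / 2) \<le> a" "a \<le> b" "b \<le> pi / 2" and z: "0 < z"
  shows "z * (1 + \<bar>z - \<bar>n\<bar>\<bar>) * cmod (integral {a..b} (\<lambda>x. cis (n * x - z * cos x))) ^ 4 \<le> 40000"
proof -
  define I where "I = cmod (integral {a..b} (\<lambda>x. cis (n * x - z * cos x)))"
  define D where "D = \<bar>z - \<bar>n\<bar>\<bar>"
  \<comment> \<open>\<open>root 3 z\<close> is the level at which the sublevel set and its complement contribute equally near a
    degenerate stationary point; away from it that level is \<open>root 4 (z * D)\<close>.\<close>
  define m where "m = root 3 z"
  have I0: "0 \<le> I" and D0: "0 \<le> D" by (auto simp: I_def D_def)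
  have m: "0 < m" "z = m ^ 3" using z by (auto simp: m_def)
  have I1: "I \<le> 10 / m" unfolding I_def by (rule bessel_phase_integral_degenerate[OF ab m])
  have "cmod (integral {a..b} (\<lambda>x. cis (n * x - z * cos x))) \<le> 1 * (b - a)"
    by (rule integral_bound[OF ab(2)]) (auto intro!: continuous_intros)
  also have "1 * (b - a) \<le> 4" using ab pi_less_4 by simp
  finally have I2: "I \<le> 4" unfolding I_def .
  have J1: "(m * I) ^ 4 \<le> 10000"
  proof -
    have "m * I \<le> 10" using I1 m by (simp add: field_simps)
    hence "(m * I) ^ 4 \<le> 10 ^ 4" using I0 m by (intro power_mono) auto
    thus ?thesis by simp
  qed
  \<comment> \<open>The cubic estimate bounds z^(4/3) I^4, which dominates z I^4 only for z >= 1;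
    for smaller z the length of the interval is enough.\<close>
  have A: "z * I ^ 4 \<le> 10000"
  proof (cases "1 \<le> z")
    case True
    hence "1 \<le> m" by (simp add: m_def)
    have "z * I ^ 4 \<le> m * (z * I ^ 4)" using mult_right_mono[OF \<open>1 \<le> m\<close>, of "z * I ^ 4"] z I0 by simp
    also have "\<dots> = (m * I) ^ 4" by (simp add: m(2) power_mult_distrib eval_nat_numeral)
    finally show ?thesis using J1 by simp
  next
    case False
    hence "z * I ^ 4 \<le> 1 * 4 ^ 4" using I0 I2 z by (intro mult_mono power_mono) auto
    thus ?thesis by simp
  qed
  have B: "z * D * I ^ 4 \<le> 30000"
  \<comment> \<open>Multiplied by D this reads (2 k)^4 <= D^4 with k^4 = z D, which is the
    hypothesis \<open>2 * m \<le> \<bar>z - \<bar>n\<bar>\<bar>\<close> of the nondegenerate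
    estimate. In the other case D <= 3 m, and the degenerate estimate already absorbs the factor
    D.\<close>
  proof (cases "16 * z \<le> D ^ 3")
    case True
    define k where "k = root 4 (z * D)"
    have "0 < D" using True z by (cases "D = 0") (use D0 in auto)
    hence k: "0 < k" "k ^ 4 = z * D" using z by (auto simp: k_def)
    have "(2 * k) ^ 4 \<le> D ^ 4"
      using mult_right_mono[OF True D0] k(2) by (simp add: power_mult_distrib eval_nat_numeral mult_ac)
    hence "2 * k \<le> D" by (subst power_mono_iff[of "2 * k" D 4, symmetric]) (use D0 k in auto)
    hence "I \<le> 10 / k" unfolding I_def
      by (intro bessel_phase_integral_nondegenerate[OF ab k(1) z]) (use k D_def in auto)
    hence "k * I \<le> 10" using k by (simp add: field_simps)
    hence "(k * I) ^ 4 \<le> 10 ^ 4" using I0 k by (intro power_mono) auto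
    thus ?thesis by (simp add: power_mult_distrib k)
  next
    case False
    have "0 < m ^ 3" using m by simp
    hence "D ^ 3 \<le> 27 * m ^ 3" using False unfolding m(2) by linarith
    hence "D ^ 3 \<le> (3 * m) ^ 3" by (simp add: power_mult_distrib)
    hence "D \<le> 3 * m" by (subst power_mono_iff[of D "3 * m" 3, symmetric]) (use D0 m in auto)
    hence "z * D * I ^ 4 \<le> z * (3 * m) * I ^ 4" using z I0 by (intro mult_right_mono mult_left_mono) auto
    also have "\<dots> = 3 * (m * I) ^ 4" by (simp add: m(2) power_mult_distrib eval_nat_numeral)
    finally show ?thesis using J1 by simp
  qed
  have "z * (1 + D) * I ^ 4 \<le> 40000" using A B by (simp add: algebra_simps)
  thus ?thesis unfolding I_def D_def .
qed

text \<open>Where the cosine is negative the phase is concave; a shift by pi and conjugation turn it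
  into the convex phase with \<open>-n\<close>. The period thus splits into three pieces, and
  3240000 = 3^4 * 40000.\<close>

lemma bessel_integral_quartic:
  fixes n z :: real
  assumes z: "0 < z"
  shows "z * (1 + \<bar>z - \<bar>n\<bar>\<bar>) * cmod (integral {-pi..pi} (\<lambda>x. cis (n * x - z * cos x))) ^ 4 \<le> 3240000"
proof -
  define f where "f x = cis (n * x - z * cos x)" for x
  define g where "g x = cis ((-n) * x - z * cos x)" for x
  have cf: "continuous_on S f" and cg: "continuous_on S g" for S unfolding f_def g_def by (auto intro!: continuous_intros)
  have i: "f integrable_on {x..y}" for x y by (intro integrable_continuous_real cf)
  define I1 where "I1 = integral {-(pi/2)..pi/2} f"
  define I2 where "I2 = integral {-(pi/2)..0} g"
  define I3 where "I3 = integral {0..pi/2} g"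
  have e2: "cmod (integral {pi/2..pi} f) = cmod I2"
  proof -
    have "(f \<circ> (\<lambda>x. x + pi)) x = cis (n * pi) * cnj (g x)" for x
      by (simp add: f_def g_def cis_cnj cis_mult algebra_simps)
    hence "integral {pi/2..pi} f = cis (n * pi) * cnj I2"
      using integral_shift[of "-(pi/2)" pi 0 f, OF cf]
      by (simp add: I2_def integral_cnj o_def add.commute flip: Henstock_Kurzweil_Integration.integral_mult_right)
    thus ?thesis by (simp add: norm_mult)
  qed
  have e3: "cmod (integral {-pi..-(pi/2)} f) = cmod I3"
  proof -
    have "(f \<circ> (\<lambda>x. x + (-pi))) x = cis (- n * pi) * cnj (g x)" for x
      by (simp add: f_def g_def cis_cnj cis_mult algebra_simps)
    hence "integral {-pi..-(pi/2)} f = cis (- n * pi) * cnj I3"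
      using integral_shift[of 0 "-pi" "pi/2" f, OF cf]
      by (simp add: I3_def integral_cnj o_def add.commute flip: Henstock_Kurzweil_Integration.integral_mult_right)
    thus ?thesis by (simp add: norm_mult)
  qed
  have "integral {-pi..pi} f = integral {-pi..-(pi/2)} f + I1 + integral {pi/2..pi} f"
    unfolding I1_def
    using Henstock_Kurzweil_Integration.integral_combine[of "-pi" "pi/2" pi f, OF _ _ i]
      Henstock_Kurzweil_Integration.integral_combine[of "-pi" "-(pi/2)" "pi/2" f, OF _ _ i]
    by simp
  hence n: "cmod (integral {-pi..pi} f) \<le> cmod I3 + cmod I1 + cmod I2"
    using e2 e3 by (metis add_mono norm_triangle_ineq order_refl order_trans)
  define M where "M = max (cmod I1) (max (cmod I2) (cmod I3))"
  have M: "cmod I1 \<le> M" "cmod I2 \<le> M" "cmod I3 \<le> M" "M \<in> {cmod I1, cmod I2, cmod I3}"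
    unfolding M_def by (auto simp: max_def)
  let ?w = "z * (1 + \<bar>z - \<bar>n\<bar>\<bar>)"
  have "?w * cmod I1 ^ 4 \<le> 40000" unfolding I1_def f_def
    by (rule bessel_phase_integral_quartic) (use z in auto)
  moreover have "?w * cmod I2 ^ 4 \<le> 40000" unfolding I2_def g_def
    using bessel_phase_integral_quartic[of "-(pi/2)" 0 z "-n"] z by simp
  moreover have "?w * cmod I3 ^ 4 \<le> 40000" unfolding I3_def g_def
    using bessel_phase_integral_quartic[of 0 "pi/2" z "-n"] z by simp
  ultimately have "?w * M ^ 4 \<le> 40000" using M(4) by auto
  moreover have "?w * cmod (integral {-pi..pi} f) ^ 4 \<le> ?w * (3 * M) ^ 4"
    using n M z by (intro mult_left_mono power_mono) auto
  ultimately show ?thesis unfolding f_def by (simp add: power_mult_distrib)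
qed

section \<open>The Schroedinger kernel\<close>

text \<open>Up to a factor of modulus one this is 2 pi J_n(2 s), with J_n the Bessel
  function.\<close>

definition schrodinger_kernel :: "int \<Rightarrow> real \<Rightarrow> complex" where
  "schrodinger_kernel n s = integral {-pi..pi} (\<lambda>\<xi>. cis (of_int n * \<xi> + s * (2 - 2 * cos \<xi>)))"

text \<open>The right-hand side of the discrete Schroedinger equation. In this form the derivative
  visibly inherits the decay of the kernel.\<close>

definition schrodinger_kernel_deriv :: "int \<Rightarrow> real \<Rightarrow> complex" where
  "schrodinger_kernel_deriv n s = \<i> *
     (2 * schrodinger_kernel n s - schrodinger_kernel (n + 1) s - schrodinger_kernel (n - 1) s)"

text \<open>One constant for the kernel and its derivative: 512 = 2 * 4^4, where 4 = 2 + 1 + 1 sums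
  the coefficients of the second difference and 2 is the cost of moving the weight from
  \<open>n\<close> to a neighbour.\<close>

definition bessel_const :: real where "bessel_const = 512 * 3240000"

lemma schrodinger_kernel_quartic_sharp:
  assumes "0 < s"
  shows "2 * s * (1 + \<bar>2 * s - \<bar>of_int n\<bar>\<bar>) * cmod (schrodinger_kernel n s) ^ 4 \<le> 3240000"
proof -
  have "cis (of_int n * x + s * (2 - 2 * cos x)) = cis (2 * s) * cis (of_int n * x - (2 * s) * cos x)" for x
    by (simp add: cis_mult algebra_simps)
  hence "schrodinger_kernel n s = cis (2 * s) * integral {-pi..pi} (\<lambda>x. cis (of_int n * x - (2 * s) * cos x))"
    unfolding schrodinger_kernel_def by simp
  thus ?thesis using bessel_integral_quartic[of "2 * s" "of_int n"] assms by (simp add: norm_mult)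
qed

lemma schrodinger_kernel_quartic:
  assumes "0 < s"
  shows "2 * s * (1 + \<bar>2 * s - \<bar>of_int n\<bar>\<bar>) * cmod (schrodinger_kernel n s) ^ 4 \<le> bessel_const"
  using schrodinger_kernel_quartic_sharp[OF assms, of n] by (simp add: bessel_const_def)

text \<open>Changing \<open>n\<close> by one changes the weight
  \<open>1 + \<bar>2 * s - \<bar>of_int n\<bar>\<bar>\<close> by at most one, hence at most doubles
  it. All three kernels in the difference therefore obey the bound with the weight of
  \<open>n\<close>.\<close>

lemma schrodinger_kernel_deriv_quartic:
  assumes s: "0 < s"
  shows "2 * s * (1 + \<bar>2 * s - \<bar>of_int n\<bar>\<bar>) * cmod (schrodinger_kernel_deriv n s) ^ 4 \<le> bessel_const"
proof -
  define M where "M = max (cmod (schrodinger_kernel n s))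
    (max (cmod (schrodinger_kernel (n + 1) s)) (cmod (schrodinger_kernel (n - 1) s)))"
  let ?w = "\<lambda>n::int. 2 * s * (1 + \<bar>2 * s - \<bar>real_of_int n\<bar>\<bar>)"
  have w: "?w n \<le> 2 * ?w k" if "\<bar>n - k\<bar> \<le> 1" for k
  proof -
    have "\<bar>real_of_int n - real_of_int k\<bar> \<le> 1" using that by linarith
    moreover have "\<bar>\<bar>real_of_int n\<bar> - \<bar>real_of_int k\<bar>\<bar> \<le> \<bar>real_of_int n - real_of_int k\<bar>"
      by (rule abs_triangle_ineq3)
    moreover have "\<bar>2 * s - \<bar>real_of_int n\<bar>\<bar> \<le> \<bar>2 * s - \<bar>real_of_int k\<bar>\<bar> + \<bar>\<bar>real_of_int n\<bar> - \<bar>real_of_int k\<bar>\<bar>"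
      using abs_triangle_ineq[of "2 * s - \<bar>real_of_int k\<bar>" "\<bar>real_of_int k\<bar> - \<bar>real_of_int n\<bar>"]
      by (simp add: abs_minus_commute)
    ultimately have "1 + \<bar>2 * s - \<bar>real_of_int n\<bar>\<bar> \<le> 2 * (1 + \<bar>2 * s - \<bar>real_of_int k\<bar>\<bar>)"
      using abs_ge_zero[of "2 * s - \<bar>real_of_int k\<bar>"] unfolding distrib_left by linarith
    from mult_left_mono[OF this, of "2 * s"] show ?thesis using s by (simp add: algebra_simps)
  qed
  have *: "?w n * cmod (schrodinger_kernel k s) ^ 4 \<le> 2 * 3240000" if "\<bar>n - k\<bar> \<le> 1" for k
    using mult_right_mono[OF w[OF that], of "cmod (schrodinger_kernel k s) ^ 4"]
      schrodinger_kernel_quartic_sharp[OF s, of k] by (simp add: algebra_simps)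
  have "M = cmod (schrodinger_kernel n s) \<or> M = cmod (schrodinger_kernel (n + 1) s)
      \<or> M = cmod (schrodinger_kernel (n - 1) s)"
    unfolding M_def max_def by simp
  then obtain k where k: "\<bar>n - k\<bar> \<le> 1" "M = cmod (schrodinger_kernel k s)"
  proof (elim disjE)
    assume "M = cmod (schrodinger_kernel n s)" thus ?thesis using that[of n] by simp
  next
    assume "M = cmod (schrodinger_kernel (n + 1) s)" thus ?thesis using that[of "n + 1"] by simp
  next
    assume "M = cmod (schrodinger_kernel (n - 1) s)" thus ?thesis using that[of "n - 1"] by simp
  qed
  have M4: "?w n * M ^ 4 \<le> 2 * 3240000" unfolding k(2) by (rule *[OF k(1)])
  have "cmod (schrodinger_kernel_deriv n s) \<le> cmod (2 * schrodinger_kernel n s)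
      + cmod (schrodinger_kernel (n + 1) s) + cmod (schrodinger_kernel (n - 1) s)"
    unfolding schrodinger_kernel_deriv_def norm_mult norm_ii mult_1
    unfolding norm_mult[symmetric]
    by (rule order_trans[OF norm_triangle_ineq4 add_right_mono[OF norm_triangle_ineq4]])
  also have "\<dots> \<le> 2 * M + M + M" by (intro add_mono) (auto simp: M_def norm_mult)
  finally have "cmod (schrodinger_kernel_deriv n s) \<le> 4 * M" by simp
  hence "?w n * cmod (schrodinger_kernel_deriv n s) ^ 4 \<le> ?w n * (4 * M) ^ 4"
    using s by (intro mult_left_mono power_mono) auto
  also have "\<dots> = 256 * (?w n * M ^ 4)" by (simp add: power_mult_distrib)
  also have "\<dots> \<le> bessel_const" using M4 by (simp add: bessel_const_def)
  finally show ?thesis .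
qed

text \<open>Differentiation under the integral produces the factor 2 - 2 cos \<xi> = 2 - cis \<xi> -
  cis (-\<xi>), and multiplying by \<open>cis \<xi>\<close> or its inverse shifts \<open>n\<close>
  by one.\<close>

lemma schrodinger_kernel_has_derivative:
  "(schrodinger_kernel n has_vector_derivative schrodinger_kernel_deriv n s) (at s)"
proof -
  define f where "f k s \<xi> = cis (of_int k * \<xi> + s * (2 - 2 * cos \<xi>))" for k :: int and s \<xi> :: real
  have fi: "f k s integrable_on {-pi..pi}" for k s
    unfolding f_def by (intro integrable_continuous_real continuous_intros)
  have d: "((\<lambda>s. integral (cbox (-pi) pi) (f n s)) has_vector_derivative
      integral (cbox (-pi) pi) (\<lambda>\<xi>. \<i> * of_real (2 - 2 * cos \<xi>) * f n s \<xi>)) (at s within UNIV)"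
  proof (rule leibniz_rule_vector_derivative)
    fix s \<xi> :: real
    show "((\<lambda>s. f n s \<xi>) has_vector_derivative \<i> * of_real (2 - 2 * cos \<xi>) * f n s \<xi>) (at s within UNIV)"
      unfolding f_def by (intro cis_has_vector_derivative) (auto intro!: derivative_eq_intros)
    show "f n s integrable_on cbox (-pi) pi" using fi by simp
  qed (auto simp: f_def case_prod_beta intro!: continuous_intros)
  have e: "\<i> * of_real (2 - 2 * cos \<xi>) * f n s \<xi> = \<i> * (2 * f n s \<xi> - f (n + 1) s \<xi> - f (n - 1) s \<xi>)" for \<xi>
  proof -
    have "f (n + 1) s \<xi> = cis \<xi> * f n s \<xi>" "f (n - 1) s \<xi> = cis (- \<xi>) * f n s \<xi>"
      by (simp_all add: f_def cis_mult algebra_simps)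
    moreover have "complex_of_real (2 - 2 * cos \<xi>) = 2 - cis \<xi> - cis (- \<xi>)" by (simp add: complex_eq_iff)
    ultimately show ?thesis by (simp only: left_diff_distrib mult.assoc)
  qed
  have k: "schrodinger_kernel k s = integral {-pi..pi} (f k s)" for k s
    by (simp add: schrodinger_kernel_def f_def[abs_def])
  have I: "integral {-pi..pi} (\<lambda>\<xi>. \<i> * (2 * f n s \<xi> - f (n + 1) s \<xi> - f (n - 1) s \<xi>)) = schrodinger_kernel_deriv n s"
    unfolding schrodinger_kernel_deriv_def k using fi
    by (simp add: Henstock_Kurzweil_Integration.integral_diff integrable_diff integrable_on_cmult_left)
  have K: "schrodinger_kernel n = (\<lambda>s. integral {-pi..pi} (f n s))" by (rule ext) (rule k)
  show ?thesis using d unfolding K I[symmetric] e cbox_interval by simp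
qed

lemma continuous_on_schrodinger_kernel: "continuous_on S (schrodinger_kernel n)"
  using schrodinger_kernel_has_derivative
  by (meson continuous_at_imp_continuous_on has_vector_derivative_continuous)

lemma continuous_on_schrodinger_kernel_deriv: "continuous_on S (schrodinger_kernel_deriv n)"
  unfolding schrodinger_kernel_deriv_def
  by (intro continuous_intros continuous_on_schrodinger_kernel)

definition lattice_kernel :: "int ^ 4 \<Rightarrow> real \<Rightarrow> complex" where
  "lattice_kernel x s = (\<Prod>j\<in>UNIV. schrodinger_kernel (x $ j) s)"

definition lattice_kernel_deriv :: "int ^ 4 \<Rightarrow> real \<Rightarrow> complex" where
  "lattice_kernel_deriv x s =
     (\<Sum>i\<in>UNIV. schrodinger_kernel_deriv (x $ i) s * (\<Prod>j\<in>UNIV - {i}. schrodinger_kernel (x $ j) s))"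

text \<open>The weights of the four coordinates; a summand is large when 2 s is near the turning
  point of its Bessel function.\<close>

definition resonance :: "int ^ 4 \<Rightarrow> real \<Rightarrow> real" where
  "resonance x s = (\<Sum>j\<in>UNIV. 1 / (1 + \<bar>2 * s - \<bar>of_int (x $ j)\<bar>\<bar>))"

lemma lattice_kernel_has_derivative:
  "(lattice_kernel x has_vector_derivative lattice_kernel_deriv x s) (at s)"
proof -
  have "((\<lambda>s. \<Prod>j\<in>UNIV. schrodinger_kernel (x $ j) s) has_derivative
      (\<lambda>y. \<Sum>i\<in>UNIV. (y *\<^sub>R schrodinger_kernel_deriv (x $ i) s) * (\<Prod>j\<in>UNIV - {i}. schrodinger_kernel (x $ j) s))) (at s)"
    by (rule has_derivative_prod)
      (use schrodinger_kernel_has_derivative in \<open>simp add: has_vector_derivative_def\<close>)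
  thus ?thesis unfolding lattice_kernel_def[abs_def] lattice_kernel_deriv_def has_vector_derivative_def
    by (simp add: scaleR_sum_right)
qed

lemma continuous_on_lattice_kernel: "continuous_on S (lattice_kernel x)"
  unfolding lattice_kernel_def by (intro continuous_intros continuous_on_schrodinger_kernel)

lemma continuous_on_lattice_kernel_deriv: "continuous_on S (lattice_kernel_deriv x)"
  unfolding lattice_kernel_deriv_def
  by (intro continuous_intros continuous_on_schrodinger_kernel continuous_on_schrodinger_kernel_deriv)

text \<open>Each factor is at most the largest one, whose power occurs in the sum. This is what
  decouples the coordinates.\<close>

lemma prod_le_sum_power_card:
  fixes a :: "'a \<Rightarrow> real"
  assumes A: "finite A" "A \<noteq> {}" and nn: "\<And>j. j \<in> A \<Longrightarrow> 0 \<le> a j"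
  shows "(\<Prod>j\<in>A. a j) \<le> (\<Sum>j\<in>A. a j ^ card A)"
proof -
  define M where "M = Max (a ` A)"
  have "M \<in> a ` A" unfolding M_def using A by (intro Max_in) auto
  then obtain k where k: "k \<in> A" "M = a k" by blast
  have "(\<Prod>j\<in>A. a j) \<le> (\<Prod>j\<in>A. M)" using A nn by (intro prod_mono) (auto simp: M_def)
  also have "\<dots> = a k ^ card A" by (simp add: k)
  also have "\<dots> \<le> (\<Sum>j\<in>A. a j ^ card A)" using A k nn by (intro member_le_sum) auto
  finally show ?thesis .
qed

text \<open>The factors \<open>u j\<close> are left arbitrary so that one of them may be the
  derivative of a kernel, as in each term of the product rule.\<close>

lemma prod_le_resonance:
  fixes u :: "4 \<Rightarrow> complex"
  assumes s: "0 < s"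
    and u: "\<And>j. 2 * s * (1 + \<bar>2 * s - \<bar>of_int (x $ j)\<bar>\<bar>) * cmod (u j) ^ 4 \<le> bessel_const"
  shows "s * cmod (\<Prod>j\<in>UNIV. u j) \<le> bessel_const / 2 * resonance x s"
proof -
  have "s * cmod (\<Prod>j\<in>UNIV. u j) \<le> s * (\<Sum>j\<in>UNIV. cmod (u j) ^ 4)"
    using prod_le_sum_power_card[of "UNIV :: 4 set" "\<lambda>j. cmod (u j)"] s
    by (simp add: prod_norm)
  also have "\<dots> \<le> (\<Sum>j\<in>UNIV. bessel_const / 2 * (1 / (1 + \<bar>2 * s - \<bar>of_int (x $ j)\<bar>\<bar>)))"
    unfolding sum_distrib_left
  proof (rule sum_mono)
    fix j
    define w where "w = 1 + \<bar>2 * s - \<bar>real_of_int (x $ j)\<bar>\<bar>"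
    have "0 < w" by (simp add: w_def)
    thus "s * cmod (u j) ^ 4 \<le> bessel_const / 2 * (1 / (1 + \<bar>2 * s - \<bar>of_int (x $ j)\<bar>\<bar>))"
      using u[of j] unfolding w_def[symmetric] by (simp add: field_simps)
  qed
  finally show ?thesis by (simp add: resonance_def sum_distrib_left)
qed

lemma lattice_kernel_bound:
  assumes "0 < s"
  shows "s * cmod (lattice_kernel x s) \<le> bessel_const / 2 * resonance x s"
  unfolding lattice_kernel_def
  by (rule prod_le_resonance[OF assms]) (rule schrodinger_kernel_quartic[OF assms])

lemma lattice_kernel_deriv_bound:
  assumes s: "0 < s"
  shows "s * cmod (lattice_kernel_deriv x s) \<le> 2 * bessel_const * resonance x s"
proof -
  have "s * cmod (lattice_kernel_deriv x s) \<le> s * (\<Sum>i\<in>UNIV. cmod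
      (schrodinger_kernel_deriv (x $ i) s * (\<Prod>j\<in>UNIV - {i}. schrodinger_kernel (x $ j) s)))"
    unfolding lattice_kernel_deriv_def using s by (intro mult_left_mono norm_sum) auto
  also have "\<dots> \<le> (\<Sum>i\<in>(UNIV::4 set). bessel_const / 2 * resonance x s)"
    unfolding sum_distrib_left
  proof (rule sum_mono)
    fix i :: 4
    define u where "u j = (if j = i then schrodinger_kernel_deriv (x $ i) s else schrodinger_kernel (x $ j) s)" for j
    have "schrodinger_kernel_deriv (x $ i) s * (\<Prod>j\<in>UNIV - {i}. schrodinger_kernel (x $ j) s) = (\<Prod>j\<in>UNIV. u j)"
      by (subst (2) prod.remove[of _ i]) (auto simp: u_def intro!: prod.cong)
    moreover have "s * cmod (\<Prod>j\<in>UNIV. u j) \<le> bessel_const / 2 * resonance x s"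
      by (rule prod_le_resonance[OF s])
        (use schrodinger_kernel_quartic[OF s] schrodinger_kernel_deriv_quartic[OF s] in \<open>auto simp: u_def\<close>)
    ultimately show "s * cmod (schrodinger_kernel_deriv (x $ i) s *
        (\<Prod>j\<in>UNIV - {i}. schrodinger_kernel (x $ j) s)) \<le> bessel_const / 2 * resonance x s" by simp
  qed
  finally show ?thesis by simp
qed

lemma resonance_bounds: "0 \<le> resonance x s" "resonance x s \<le> 4"
proof -
  show "0 \<le> resonance x s" unfolding resonance_def by (intro sum_nonneg) auto
  have "resonance x s \<le> (\<Sum>j\<in>(UNIV::4 set). 1)"
    unfolding resonance_def by (intro sum_mono) (simp add: field_simps)
  thus "resonance x s \<le> 4" by simp
qed

section \<open>Time integrals of the lattice kernel\<close>

text \<open>Source of the logarithm, and of its uniformity in x: the bound depends on the length of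
  the interval only, not on its position. It holds because y + sqrt (y^2 + 1) exceeds the same
  expression at x by at most 2 (y - x), and the latter is at least 1.\<close>

lemma arsinh_diff_le_nonneg:
  fixes x y :: real
  assumes "0 \<le> x" "x \<le> y"
  shows "arsinh y - arsinh x \<le> ln (1 + 2 * (y - x))"
proof -
  define d where "d = y - x"
  have d: "0 \<le> d" "y = x + d" using assms by (auto simp: d_def)
  define q where "q = sqrt (x\<^sup>2 + 1)"
  have q2: "q\<^sup>2 = x\<^sup>2 + 1" by (simp add: q_def)
  have q1: "1 \<le> q" by (simp add: q_def)
  have xq: "x \<le> q" unfolding q_def by (rule real_le_rsqrt) simp
  have "sqrt (y\<^sup>2 + 1) \<le> q + d"
  proof (rule real_le_lsqrt)
    have "2 * (x * d) \<le> 2 * (q * d)" using xq d by (simp add: mult_right_mono)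
    thus "y\<^sup>2 + 1 \<le> (q + d)\<^sup>2" using q2 by (simp add: d(2) power2_sum)
  qed (use q1 d in auto)
  hence "y + sqrt (y\<^sup>2 + 1) \<le> (x + q) + 2 * d * 1" by (simp add: d(2))
  also have "\<dots> \<le> (x + q) + 2 * d * (x + q)" using d q1 assms by (intro add_left_mono mult_left_mono) auto
  finally have "y + sqrt (y\<^sup>2 + 1) \<le> (1 + 2 * d) * (x + q)" by (simp add: algebra_simps)
  hence "arsinh y \<le> ln ((1 + 2 * d) * (x + q))"
    unfolding arsinh_real_def by (intro ln_mono) (use assms in \<open>auto intro!: add_nonneg_pos\<close>)
  also have "\<dots> = ln (1 + 2 * d) + ln (x + q)" using d q1 assms by (intro ln_mult_pos) auto
  finally show ?thesis by (simp add: arsinh_real_def q_def d_def)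
qed

text \<open>The factor 2 pays for an interval that contains 0, which is cut there and
  reflected.\<close>

lemma arsinh_diff_le:
  fixes x y :: real
  assumes "x \<le> y"
  shows "arsinh y - arsinh x \<le> 2 * ln (1 + 2 * (y - x))"
proof -
  have ln0: "0 \<le> ln (1 + 2 * (y - x))" using assms by simp
  consider "0 \<le> x" | "y \<le> 0" | "x < 0" "0 < y" by linarith
  thus ?thesis
  proof cases
    case 1 thus ?thesis using arsinh_diff_le_nonneg[of x y] assms ln0 by linarith
  next
    case 2
    hence "arsinh (-x) - arsinh (-y) \<le> ln (1 + 2 * (-x - (-y)))"
      using assms by (intro arsinh_diff_le_nonneg) auto
    moreover have "-x - (-y) = y - x" by simp
    ultimately show ?thesis using ln0 by (simp add: arsinh_minus_real)
  next
    case 3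
    have "arsinh y - arsinh 0 \<le> ln (1 + 2 * (y - 0))" "arsinh (-x) - arsinh 0 \<le> ln (1 + 2 * (-x - 0))"
      using 3 by (intro arsinh_diff_le_nonneg; simp)+
    moreover have "ln (1 + 2 * (y - 0)) \<le> ln (1 + 2 * (y - x))" "ln (1 + 2 * (-x - 0)) \<le> ln (1 + 2 * (y - x))"
      using 3 by auto
    ultimately show ?thesis by (simp add: arsinh_minus_real)
  qed
qed

lemma norm_integral_le_primitive:
  fixes F :: "real \<Rightarrow> 'a::euclidean_space"
  assumes ab: "a \<le> b" and F: "F integrable_on {a..b}"
    and d: "\<And>r. r \<in> {a..b} \<Longrightarrow> (\<Phi> has_real_derivative \<phi> r) (at r)"
    and le: "\<And>r. r \<in> {a..b} \<Longrightarrow> norm (F r) \<le> \<phi> r"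
  shows "norm (integral {a..b} F) \<le> \<Phi> b - \<Phi> a"
proof -
  have "(\<phi> has_integral \<Phi> b - \<Phi> a) {a..b}"
    using fundamental_theorem_of_calculus[OF ab, of \<Phi> \<phi>] d
    by (simp add: has_real_derivative_iff_has_vector_derivative[symmetric] has_field_derivative_at_within)
  thus ?thesis using integral_norm_bound_integral[OF F _ le] by (metis has_integral_integrable_integral)
qed

text \<open>A smooth majorant of the weight. Composed with 2 r^2 - n and multiplied by r it has an
  arsinh as primitive, across the resonance without a case split.\<close>

lemma abs_inverse_le_sqrt: "1 / (1 + \<bar>y\<bar>) \<le> 1 / sqrt (y\<^sup>2 + 1)" for y :: real
proof -
  have "sqrt (y\<^sup>2 + 1) \<le> 1 + \<bar>y\<bar>"
    by (rule real_le_lsqrt) (auto simp: power2_eq_square algebra_simps)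
  thus ?thesis by (intro divide_left_mono mult_pos_pos) (auto intro: add_nonneg_pos)
qed

lemma arsinh_quadratic_deriv:
  "((\<lambda>r. arsinh (2 * r\<^sup>2 - n) / 4) has_real_derivative r / sqrt ((2 * r\<^sup>2 - n)\<^sup>2 + 1)) (at (r::real))"
proof -
  have "((\<lambda>r. 2 * r\<^sup>2 - n) has_real_derivative 4 * r) (at r)"
    by (auto intro!: derivative_eq_intros)
  from DERIV_cdivide[OF DERIV_chain2[OF arsinh_real_has_field_derivative this], of 4]
  show ?thesis by simp
qed

lemma resonance_le:
  "resonance x (r\<^sup>2) \<le> (\<Sum>j\<in>UNIV. 1 / sqrt ((2 * r\<^sup>2 - \<bar>of_int (x $ j)\<bar>)\<^sup>2 + 1))"
  unfolding resonance_def by (intro sum_mono abs_inverse_le_sqrt)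

text \<open>The modulus of the integrand is at most a sum of terms L' / r^3 with L an arsinh whose
  increments grow logarithmically. The bound is free of \<open>R\<close>, as the later limit
  requires.\<close>

lemma lattice_kernel_outer:
  assumes T: "0 < T" and TR: "T \<le> R"
  shows "cmod (integral {T..R} (\<lambda>r. cis (t\<^sup>2 / (4 * r\<^sup>2)) * lattice_kernel x (r\<^sup>2)))
    \<le> 2 * bessel_const * (ln (1 + 4 * T\<^sup>2) + 1) / T ^ 3"
proof -
  define n where "n j = \<bar>real_of_int (x $ j)\<bar>" for j
  define L where "L j r = arsinh (2 * r\<^sup>2 - n j) / 4" for j r
  define L' where "L' j r = r / sqrt ((2 * r\<^sup>2 - n j)\<^sup>2 + 1)" for j r
  have dL: "(L j has_real_derivative L' j r) (at r)" for j r
    unfolding L_def L'_def by (rule arsinh_quadratic_deriv)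
  have Lle: "L j r - L j T \<le> ln (1 + 4 * r\<^sup>2) / 2" if "T \<le> r" for j r
  proof -
    have "T\<^sup>2 \<le> r\<^sup>2" using that T by (intro power_mono) auto
    hence "arsinh (2 * r\<^sup>2 - n j) - arsinh (2 * T\<^sup>2 - n j) \<le> 2 * ln (1 + 2 * (2 * r\<^sup>2 - n j - (2 * T\<^sup>2 - n j)))"
      by (intro arsinh_diff_le) simp
    also have "\<dots> \<le> 2 * ln (1 + 4 * r\<^sup>2)" using \<open>T\<^sup>2 \<le> r\<^sup>2\<close> by (auto intro!: ln_mono add_pos_nonneg)
    finally show ?thesis by (simp add: L_def)
  qed
  define \<Phi> where "\<Phi> j r = (L j r - L j T - ln (1 + 4 * r\<^sup>2) - 1) / r ^ 3" for j r
  define \<phi> where "\<phi> j r = (L' j r - 8 * r / (1 + 4 * r\<^sup>2)) / r ^ 3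
    - 3 * (L j r - L j T - ln (1 + 4 * r\<^sup>2) - 1) / r ^ 4" for j r
  have d\<Phi>: "(\<Phi> j has_real_derivative \<phi> j r) (at r)" if "T \<le> r" for j r
  proof -
    have r: "0 < r" using that T by simp
    have p: "0 < 1 + 4 * r\<^sup>2" by (simp add: add_pos_nonneg)
    have "(\<Phi> j has_real_derivative
      ((L' j r - 8 * r / (1 + 4 * r\<^sup>2)) * r ^ 3 - (L j r - L j T - ln (1 + 4 * r\<^sup>2) - 1) * (3 * r\<^sup>2)) / (r ^ 3 * r ^ 3)) (at r)"
      unfolding \<Phi>_def
      by (rule DERIV_divide) (use r p in \<open>auto intro!: derivative_eq_intros dL\<close>)
    also have "((L' j r - 8 * r / (1 + 4 * r\<^sup>2)) * r ^ 3 - (L j r - L j T - ln (1 + 4 * r\<^sup>2) - 1) * (3 * r\<^sup>2)) / (r ^ 3 * r ^ 3) = \<phi> j r"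
    proof -
      have "(B * r ^ 3 - A * (3 * r\<^sup>2)) / (r ^ 3 * r ^ 3) = B / r ^ 3 - 3 * A / r ^ 4" for A B
        using r by (simp add: diff_divide_distrib eval_nat_numeral)
      thus ?thesis by (simp only: \<phi>_def)
    qed
    finally show ?thesis .
  qed
  have le: "1 / sqrt ((2 * r\<^sup>2 - n j)\<^sup>2 + 1) / r\<^sup>2 \<le> \<phi> j r" if "T \<le> r" for j r
  proof -
    have r: "0 < r" using that T by simp
    have p: "0 < 1 + 4 * r\<^sup>2" by (simp add: add_pos_nonneg)
    have a: "8 * r / (1 + 4 * r\<^sup>2) / r ^ 3 \<le> 2 / r ^ 4"
    proof -
      have "8 * r / (1 + 4 * r\<^sup>2) \<le> 2 / r"
        using r by (subst pos_divide_le_eq[OF p]) (simp add: field_simps power2_eq_square)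
      from divide_right_mono[OF this, of "r ^ 3"] show ?thesis
        using r by (simp add: eval_nat_numeral)
    qed
    \<comment> \<open>The remainder is worth at least 3 / r^4 and so covers the loss 2 / r^4 from
      differentiating the subtracted logarithm.\<close>
    have "2 \<le> - 3 * (u - l - 1)" if "0 \<le> l" "u \<le> l / 2" for u l :: real
      using that by (simp add: field_simps)
    from this[OF _ Lle[OF that, of j]]
    have "2 \<le> - 3 * (L j r - L j T - ln (1 + 4 * r\<^sup>2) - 1)" by simp
    hence "2 / r ^ 4 \<le> - 3 * (L j r - L j T - ln (1 + 4 * r\<^sup>2) - 1) / r ^ 4"
      using r by (intro divide_right_mono) auto
    also have "\<dots> = - (3 * (L j r - L j T - ln (1 + 4 * r\<^sup>2) - 1) / r ^ 4)"
      by (simp only: mult_minus_left minus_divide_left)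
    finally have "2 / r ^ 4 \<le> \<dots>" .
    moreover have "1 / sqrt ((2 * r\<^sup>2 - n j)\<^sup>2 + 1) / r\<^sup>2 = L' j r / r ^ 3"
      unfolding L'_def using r by (simp add: eval_nat_numeral)
    moreover have "\<phi> j r = L' j r / r ^ 3 - 8 * r / (1 + 4 * r\<^sup>2) / r ^ 3
        - 3 * (L j r - L j T - ln (1 + 4 * r\<^sup>2) - 1) / r ^ 4"
      unfolding \<phi>_def by (simp only: diff_divide_distrib)
    ultimately show ?thesis using a by linarith
  qed
  have c: "continuous_on {T..R} (\<lambda>r. cis (t\<^sup>2 / (4 * r\<^sup>2)) * lattice_kernel x (r\<^sup>2))"
    by (intro continuous_intros continuous_on_compose2[OF continuous_on_lattice_kernel[of UNIV]]) (use T in auto)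
  have "cmod (integral {T..R} (\<lambda>r. cis (t\<^sup>2 / (4 * r\<^sup>2)) * lattice_kernel x (r\<^sup>2)))
    \<le> (\<Sum>j\<in>UNIV. bessel_const / 2 * \<Phi> j R) - (\<Sum>j\<in>UNIV. bessel_const / 2 * \<Phi> j T)"
  proof (rule norm_integral_le_primitive[OF TR integrable_continuous_real[OF c]])
    fix r assume r: "r \<in> {T..R}"
    show "((\<lambda>r. \<Sum>j\<in>UNIV. bessel_const / 2 * \<Phi> j r) has_real_derivative (\<Sum>j\<in>UNIV. bessel_const / 2 * \<phi> j r)) (at r)"
      using r by (intro DERIV_sum DERIV_cmult d\<Phi>) auto
    have r0: "0 < r\<^sup>2" using r T by auto
    have "r\<^sup>2 * cmod (lattice_kernel x (r\<^sup>2)) \<le> bessel_const / 2 * resonance x (r\<^sup>2)"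
      by (rule lattice_kernel_bound[OF r0])
    also have "\<dots> \<le> bessel_const / 2 * (\<Sum>j\<in>UNIV. 1 / sqrt ((2 * r\<^sup>2 - n j)\<^sup>2 + 1))"
      using resonance_le[of x r] by (intro mult_left_mono) (auto simp: n_def bessel_const_def)
    finally have "cmod (lattice_kernel x (r\<^sup>2)) \<le> bessel_const / 2 * (\<Sum>j\<in>UNIV. 1 / sqrt ((2 * r\<^sup>2 - n j)\<^sup>2 + 1)) / r\<^sup>2"
      using r0 by (simp add: pos_le_divide_eq mult_ac)
    also have "\<dots> = (\<Sum>j\<in>UNIV. bessel_const / 2 * (1 / sqrt ((2 * r\<^sup>2 - n j)\<^sup>2 + 1) / r\<^sup>2))"
      by (simp add: sum_distrib_left sum_divide_distrib mult.assoc)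
    also have "\<dots> \<le> (\<Sum>j\<in>UNIV. bessel_const / 2 * \<phi> j r)"
      using r le by (intro sum_mono mult_left_mono) (auto simp: bessel_const_def)
    finally show "cmod (cis (t\<^sup>2 / (4 * r\<^sup>2)) * lattice_kernel x (r\<^sup>2)) \<le> (\<Sum>j\<in>UNIV. bessel_const / 2 * \<phi> j r)"
      by (simp add: norm_mult)
  qed
  also have "\<dots> = (\<Sum>j\<in>UNIV. bessel_const / 2 * (\<Phi> j R - \<Phi> j T))"
    by (simp add: sum_subtractf right_diff_distrib)
  also have "\<dots> \<le> (\<Sum>j\<in>(UNIV::4 set). bessel_const / 2 * ((ln (1 + 4 * T\<^sup>2) + 1) / T ^ 3))"
  proof (intro sum_mono mult_left_mono)
    fix j
    have "0 \<le> ln (1 + 4 * R\<^sup>2)" by simp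
    hence "L j R - L j T - ln (1 + 4 * R\<^sup>2) - 1 \<le> 0" using Lle[OF TR, of j] by linarith
    hence "\<Phi> j R \<le> 0" unfolding \<Phi>_def using T TR by (simp add: divide_nonpos_pos)
    moreover have "\<Phi> j T = - ((ln (1 + 4 * T\<^sup>2) + 1) / T ^ 3)"
      by (simp add: \<Phi>_def minus_divide_left)
    ultimately show "\<Phi> j R - \<Phi> j T \<le> (ln (1 + 4 * T\<^sup>2) + 1) / T ^ 3" by simp
  qed (auto simp: bessel_const_def)
  finally show ?thesis by simp
qed

text \<open>The factor r suppresses the unbounded oscillation at 0, where division by zero makes the
  value 0 as well.\<close>

lemma continuous_on_id_cis_inverse: "continuous_on S (\<lambda>r. of_real r * cis (t / r\<^sup>2))"
proof -
  have "isCont (\<lambda>r. of_real r * cis (t / r\<^sup>2)) r" for r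
  proof (cases "r = 0")
    case True
    have "((\<lambda>r. of_real r * cis (t / r\<^sup>2)) \<longlongrightarrow> 0) (at 0)"
      by (rule Lim_null_comparison[where g = "\<lambda>r. \<bar>r\<bar>"])
        (auto simp: norm_mult intro!: tendsto_eq_intros always_eventually)
    thus ?thesis by (simp add: True isCont_def)
  next
    case False
    have "isCont cis u" for u
      using continuous_on_cis[OF continuous_on_id[of UNIV]] by (simp add: continuous_on_eq_continuous_at)
    from isCont_o2[OF _ this, of r "\<lambda>r. t / r\<^sup>2"] False
    show ?thesis by (intro continuous_intros) auto
  qed
  thus ?thesis by (meson continuous_at_imp_continuous_on)
qed

text \<open>After the integration by parts the kernel carries r^2 / t^2 and its derivative r^4 /
  t^2. Since r^2 times either is bounded by the weights, the first term integrates to order T / t^2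
  = T^(-3), and the second to the same order times a logarithm.\<close>

lemma lattice_kernel_inner:
  fixes x :: "int ^ 4"
  assumes t: "0 < t"
  defines "T \<equiv> sqrt t"
  defines "f \<equiv> (\<lambda>r. cis (t\<^sup>2 / (4 * r\<^sup>2)) * lattice_kernel x (r\<^sup>2))"
  shows "f integrable_on {0..T}"
    and "cmod (integral {0..T} f) \<le> bessel_const * (16 + 16 * ln (1 + 4 * t)) / T ^ 3"
proof -
  have T: "0 < T" "T\<^sup>2 = t" using t by (auto simp: T_def)
  define e where "e r = complex_of_real r * cis (t\<^sup>2 / 4 / r\<^sup>2)" for r
  have ce: "continuous_on S e" for S unfolding e_def by (rule continuous_on_id_cis_inverse)
  have cP: "continuous_on S (\<lambda>r. lattice_kernel x (r\<^sup>2))" "continuous_on S (\<lambda>r. lattice_kernel_deriv x (r\<^sup>2))" for S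
    by (auto intro!: continuous_intros continuous_on_compose2[OF continuous_on_lattice_kernel[of UNIV]]
        continuous_on_compose2[OF continuous_on_lattice_kernel_deriv[of UNIV]])
  \<comment> \<open>\<open>V\<close> is the integrand divided by the derivative of the exponent \<open>it\<^sup>2/(4r\<^sup>2)\<close>.\<close>
  define V where "V r = \<i> * of_real (2 * r\<^sup>2 / t\<^sup>2) * e r * lattice_kernel x (r\<^sup>2)" for r
  define W where "W r = \<i> * of_real (6 * r / t\<^sup>2) * e r * lattice_kernel x (r\<^sup>2)
    + \<i> * of_real (4 * r ^ 3 / t\<^sup>2) * e r * lattice_kernel_deriv x (r\<^sup>2)" for r
  have cV: "continuous_on {0..T} V" unfolding V_def by (intro continuous_intros ce cP) (use t in auto)
  have cW: "continuous_on {0..T} W" unfolding W_def by (intro continuous_intros ce cP) (use t in auto)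
  have dV: "(V has_vector_derivative f r + W r) (at r)" if r: "0 < r" for r
  proof -
    have "((\<lambda>r. t\<^sup>2 / 4 / r\<^sup>2) has_real_derivative - (t\<^sup>2 / (2 * r ^ 3))) (at r)"
      using r by (auto intro!: derivative_eq_intros simp: eval_nat_numeral field_simps)
    note 1 = cis_has_vector_derivative[OF this]
    have "((\<lambda>r. 2 * r ^ 3 / t\<^sup>2) has_real_derivative 6 * r\<^sup>2 / t\<^sup>2) (at r)"
      using t by (auto intro!: derivative_eq_intros simp: field_simps)
    note 2 = has_vector_derivative_of_real[OF this]
    have "((\<lambda>r. r\<^sup>2) has_vector_derivative 2 * r) (at r)"
      unfolding has_real_derivative_iff_has_vector_derivative[symmetric] by (auto intro!: derivative_eq_intros)
    from vector_diff_chain_at[OF this lattice_kernel_has_derivative[of x "r\<^sup>2"]]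
    have 3: "((\<lambda>r. lattice_kernel x (r\<^sup>2)) has_vector_derivative (2 * r) *\<^sub>R lattice_kernel_deriv x (r\<^sup>2)) (at r)"
      by (simp add: o_def)
    have "V = (\<lambda>r. (\<i> * of_real (2 * r ^ 3 / t\<^sup>2)) * (cis (t\<^sup>2 / 4 / r\<^sup>2) * lattice_kernel x (r\<^sup>2)))"
      by (simp add: V_def e_def fun_eq_iff eval_nat_numeral mult_ac)
    moreover have "(\<dots> has_vector_derivative f r + W r) (at r)"
      by (rule has_vector_derivative_eq_rhs[OF has_vector_derivative_mult[OF has_vector_derivative_mult_right[OF 2] has_vector_derivative_mult[OF 1 3]]])
        (use r t in \<open>simp add: f_def W_def e_def scaleR_conv_of_real field_simps eval_nat_numeral\<close>)
    ultimately show ?thesis by simp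
  qed
  \<comment> \<open>\<open>f\<close> need not be continuous at 0; the rule asks for continuity of
    \<open>V\<close> only, and integrability of \<open>f\<close> is a consequence.\<close>
  have i: "((\<lambda>r. f r + W r) has_integral V T - V 0) {0..T}"
    by (rule fundamental_theorem_of_calculus_interior) (use T cV dV in auto)
  have iW: "W integrable_on {0..T}" using cW by (rule integrable_continuous_real)
  have "((\<lambda>r. (f r + W r) - W r) has_integral (V T - V 0) - integral {0..T} W) {0..T}"
    by (intro has_integral_diff i) (use iW in \<open>simp add: has_integral_integral\<close>)
  hence h: "(f has_integral V T - integral {0..T} W) {0..T}" by (simp add: V_def e_def)
  thus "f integrable_on {0..T}" by blast
  define n where "n j = \<bar>real_of_int (x $ j)\<bar>" for j
  define L where "L j r = arsinh (2 * r\<^sup>2 - n j) / 4" for j r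
  define L' where "L' j r = r / sqrt ((2 * r\<^sup>2 - n j)\<^sup>2 + 1)" for j r
  have dL: "(L j has_real_derivative L' j r) (at r)" for j r
    unfolding L_def L'_def by (rule arsinh_quadratic_deriv)
  have b0: "0 \<le> bessel_const" by (simp add: bessel_const_def)
  have bP: "r\<^sup>2 * cmod (lattice_kernel x (r\<^sup>2)) \<le> 2 * bessel_const" for r
  proof (cases "r = 0")
    case False
    hence "r\<^sup>2 * cmod (lattice_kernel x (r\<^sup>2)) \<le> bessel_const / 2 * resonance x (r\<^sup>2)"
      by (intro lattice_kernel_bound) auto
    also have "\<dots> \<le> bessel_const / 2 * 4" using resonance_bounds b0 by (intro mult_left_mono) auto
    finally show ?thesis by simp
  qed (simp add: b0)
  have ne: "cmod (e r) = \<bar>r\<bar>" for r by (simp add: e_def norm_mult)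
  have "cmod (integral {0..T} W) \<le> (12 * bessel_const / t\<^sup>2 * T + (\<Sum>j\<in>UNIV. 8 * bessel_const * T / t\<^sup>2 * L j T))
     - (12 * bessel_const / t\<^sup>2 * 0 + (\<Sum>j\<in>UNIV. 8 * bessel_const * T / t\<^sup>2 * L j 0))"
  proof (rule norm_integral_le_primitive[OF _ iW])
    show "0 \<le> T" using T by simp
    fix r assume r: "r \<in> {0..T}"
    show "((\<lambda>r. 12 * bessel_const / t\<^sup>2 * r + (\<Sum>j\<in>UNIV. 8 * bessel_const * T / t\<^sup>2 * L j r)) has_real_derivative
        12 * bessel_const / t\<^sup>2 + (\<Sum>j\<in>UNIV. 8 * bessel_const * T / t\<^sup>2 * L' j r)) (at r)"
      by (intro DERIV_add[OF DERIV_cmult_Id] DERIV_sum DERIV_cmult dL)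
    have W: "cmod (W r) \<le> 6 * r / t\<^sup>2 * r * cmod (lattice_kernel x (r\<^sup>2)) + 4 * r ^ 3 / t\<^sup>2 * r * cmod (lattice_kernel_deriv x (r\<^sup>2))"
      unfolding W_def using r
      by (intro order_trans[OF norm_triangle_ineq]) (simp add: norm_mult norm_divide norm_power ne)
    have "6 * r / t\<^sup>2 * r * cmod (lattice_kernel x (r\<^sup>2)) = 6 / t\<^sup>2 * (r\<^sup>2 * cmod (lattice_kernel x (r\<^sup>2)))"
      by (simp add: power2_eq_square)
    also have "6 / t\<^sup>2 * (r\<^sup>2 * cmod (lattice_kernel x (r\<^sup>2))) \<le> 6 / t\<^sup>2 * (2 * bessel_const)"
      by (intro mult_left_mono bP) auto
    also have "6 / t\<^sup>2 * (2 * bessel_const) = 12 * bessel_const / t\<^sup>2" by simp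
    finally have W1: "6 * r / t\<^sup>2 * r * cmod (lattice_kernel x (r\<^sup>2)) \<le> \<dots>" .
    have "4 * r ^ 3 / t\<^sup>2 * r * cmod (lattice_kernel_deriv x (r\<^sup>2)) = 4 * r\<^sup>2 / t\<^sup>2 * (r\<^sup>2 * cmod (lattice_kernel_deriv x (r\<^sup>2)))"
      by (simp add: eval_nat_numeral)
    \<comment> \<open>Only one factor r is replaced by \<open>T\<close>; the other is the Jacobian
      that turns the weights into \<open>L'\<close>.\<close>
    also have "\<dots> \<le> 4 * (T * r) / t\<^sup>2 * (2 * bessel_const * (\<Sum>j\<in>UNIV. 1 / sqrt ((2 * r\<^sup>2 - n j)\<^sup>2 + 1)))"
    proof (cases "r = 0")
      case False
      have "r\<^sup>2 * cmod (lattice_kernel_deriv x (r\<^sup>2)) \<le> 2 * bessel_const * resonance x (r\<^sup>2)"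
        by (rule lattice_kernel_deriv_bound) (use False in auto)
      also have "\<dots> \<le> 2 * bessel_const * (\<Sum>j\<in>UNIV. 1 / sqrt ((2 * r\<^sup>2 - n j)\<^sup>2 + 1))"
        using resonance_le[of x r] b0 by (intro mult_left_mono) (auto simp: n_def)
      finally have *: "r\<^sup>2 * cmod (lattice_kernel_deriv x (r\<^sup>2)) \<le> \<dots>" .
      show ?thesis
        by (rule mult_mono[OF _ *])
          (use r T in \<open>auto simp: power2_eq_square intro!: divide_right_mono mult_right_mono mult_nonneg_nonneg\<close>)
    qed auto
    also have "\<dots> = (\<Sum>j\<in>UNIV. 8 * bessel_const * T / t\<^sup>2 * L' j r)"
      by (simp add: L'_def sum_distrib_left mult_ac)
    finally have "4 * r ^ 3 / t\<^sup>2 * r * cmod (lattice_kernel_deriv x (r\<^sup>2)) \<le> \<dots>" .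
    thus "cmod (W r) \<le> 12 * bessel_const / t\<^sup>2 + (\<Sum>j\<in>UNIV. 8 * bessel_const * T / t\<^sup>2 * L' j r)"
      using W W1 by linarith
  qed
  also have "\<dots> = 12 * bessel_const / t\<^sup>2 * T + (\<Sum>j\<in>UNIV. 8 * bessel_const * T / t\<^sup>2 * (L j T - L j 0))"
    by (simp add: sum_subtractf right_diff_distrib)
  also have "(\<Sum>j\<in>UNIV. 8 * bessel_const * T / t\<^sup>2 * (L j T - L j 0))
      \<le> (\<Sum>j\<in>(UNIV::4 set). 8 * bessel_const * T / t\<^sup>2 * (ln (1 + 4 * t) / 2))"
  proof (intro sum_mono mult_left_mono)
    fix j
    have "arsinh (2 * T\<^sup>2 - n j) - arsinh (2 * 0\<^sup>2 - n j) \<le> 2 * ln (1 + 2 * (2 * T\<^sup>2 - n j - (2 * 0\<^sup>2 - n j)))"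
      by (intro arsinh_diff_le) simp
    thus "L j T - L j 0 \<le> ln (1 + 4 * t) / 2" by (simp add: L_def T(2))
  qed (use b0 T in auto)
  finally have bW: "cmod (integral {0..T} W) \<le> bessel_const * T / t\<^sup>2 * (12 + 16 * ln (1 + 4 * t))"
    by (simp add: algebra_simps)
  have "cmod (V T) = 2 * T / t\<^sup>2 * (T\<^sup>2 * cmod (lattice_kernel x (T\<^sup>2)))"
    unfolding V_def using T t by (simp add: norm_mult norm_divide norm_power ne power2_eq_square)
  also have "\<dots> \<le> 2 * T / t\<^sup>2 * (2 * bessel_const)" by (intro mult_left_mono bP) (use T in auto)
  finally have bV: "cmod (V T) \<le> bessel_const * T / t\<^sup>2 * 4" by (simp add: mult_ac)
  have "cmod (integral {0..T} f) \<le> cmod (V T) + cmod (integral {0..T} W)"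
    using h by (metis integral_unique norm_triangle_ineq4)
  also have "\<dots> \<le> bessel_const * T / t\<^sup>2 * (16 + 16 * ln (1 + 4 * t))"
    using add_mono[OF bV bW] by (simp add: algebra_simps)
  also have "bessel_const * T / t\<^sup>2 = bessel_const / T ^ 3"
    unfolding T(2)[symmetric] using T(1) by (simp add: eval_nat_numeral)
  finally show "cmod (integral {0..T} f) \<le> bessel_const * (16 + 16 * ln (1 + 4 * t)) / T ^ 3" by simp
qed

section \<open>Fresnel integrals and subordination\<close>

lemma fresnel_tail:
  assumes "0 < V" "V \<le> W"
  shows "cmod (integral {V..W} (\<lambda>v. cis (v\<^sup>2))) \<le> 1 / V"
proof -
  have "cmod (integral {V..W} (\<lambda>v. cis (v\<^sup>2))) \<le> 2 / (2 * V)"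
    by (rule van_der_corput_increasing[where \<psi>' = "\<lambda>v. 2 * v" and \<psi>'' = "\<lambda>_. 2"])
      (use assms in \<open>auto intro!: derivative_eq_intros continuous_intros\<close>)
  thus ?thesis by simp
qed

definition fresnel :: "real \<Rightarrow> complex" where
  "fresnel X = integral {0..X} (\<lambda>v. cis (v\<^sup>2))"

lemma fresnel_integrable: "(\<lambda>v. cis (v\<^sup>2)) integrable_on {a..b}"
  by (intro integrable_continuous_real continuous_intros)

lemma fresnel_diff:
  assumes "0 < V" "V \<le> W"
  shows "cmod (fresnel W - fresnel V) \<le> 1 / V"
proof -
  have "fresnel V + integral {V..W} (\<lambda>v. cis (v\<^sup>2)) = fresnel W" unfolding fresnel_def
    by (rule Henstock_Kurzweil_Integration.integral_combine) (use assms fresnel_integrable in auto)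
  thus ?thesis using fresnel_tail[OF assms] by (metis add_diff_cancel_left')
qed

lemma fresnel_bound:
  assumes "0 \<le> X"
  shows "cmod (fresnel X) \<le> 2"
proof -
  have *: "cmod (fresnel Y) \<le> 1 * (Y - 0)" if "0 \<le> Y" for Y
    unfolding fresnel_def by (rule integral_bound[OF that]) (auto intro!: continuous_intros)
  show ?thesis
  proof (cases "X \<le> 1")
    case True thus ?thesis using *[OF assms] by simp
  next
    case False
    hence "cmod (fresnel X - fresnel 1) \<le> 1" using fresnel_diff[of 1 X] by simp
    moreover have "cmod (fresnel 1) \<le> 1" using *[of 1] by simp
    ultimately show ?thesis using norm_triangle_sub[of "fresnel X" "fresnel 1"] by linarith
  qed
qed

text \<open>Nonvanishing is numerical: the tail beyond X is at most 1 / X, so it suffices that the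
  integral up to one X exceeds 1 / X. At X = 5/4 the bound cos y >= 1 - y^2 / 2 gives more than 0.94
  against 4/5.\<close>

lemma fresnel_limit:
  obtains \<kappa> where "\<kappa> \<noteq> 0" "(fresnel \<longlongrightarrow> \<kappa>) at_top"
proof -
  have "Cauchy (\<lambda>n. fresnel (real (Suc n)))"
  proof (rule metric_CauchyI)
    fix e :: real assume "0 < e"
    then obtain M where M: "inverse (real (Suc M)) < e" using reals_Archimedean by blast
    have "dist (fresnel (real (Suc m))) (fresnel (real (Suc n))) < e" if "M \<le> m" "m \<le> n" for m n
    proof -
      have "dist (fresnel (real (Suc m))) (fresnel (real (Suc n))) \<le> 1 / real (Suc m)"
        using fresnel_diff[of "real (Suc m)" "real (Suc n)"] that by (simp add: dist_norm norm_minus_commute)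
      also have "\<dots> \<le> 1 / real (Suc M)" using that by (intro divide_left_mono) auto
      finally show ?thesis using M by (simp add: inverse_eq_divide)
    qed
    hence "\<forall>m\<ge>M. \<forall>n\<ge>M. dist (fresnel (real (Suc m))) (fresnel (real (Suc n))) < e"
      by (metis dist_commute nle_le)
    thus "\<exists>M. \<forall>m\<ge>M. \<forall>n\<ge>M. dist (fresnel (real (Suc m))) (fresnel (real (Suc n))) < e" by blast
  qed
  then obtain \<kappa> where \<kappa>: "(\<lambda>n. fresnel (real (Suc n))) \<longlonglongrightarrow> \<kappa>"
    using Cauchy_convergent convergent_def by blast
  have close: "cmod (\<kappa> - fresnel X) \<le> 1 / X" if "0 < X" for X
  proof (rule tendsto_upperbound)
    show "(\<lambda>n. cmod (fresnel (real (Suc n)) - fresnel X)) \<longlonglongrightarrow> cmod (\<kappa> - fresnel X)"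
      by (intro tendsto_intros \<kappa>)
    show "\<forall>\<^sub>F n in sequentially. cmod (fresnel (real (Suc n)) - fresnel X) \<le> 1 / X"
      using eventually_ge_at_top[of "nat \<lceil>X\<rceil>"]
    proof eventually_elim
      case (elim n)
      hence "X \<le> real (Suc n)" by linarith
      thus ?case using fresnel_diff[OF that] by blast
    qed
  qed auto
  show ?thesis
  proof (rule that)
    have "((\<lambda>X. fresnel X - \<kappa>) \<longlongrightarrow> 0) at_top"
    proof (rule Lim_null_comparison)
      show "\<forall>\<^sub>F X in at_top. cmod (fresnel X - \<kappa>) \<le> 1 / X"
        using eventually_gt_at_top[of 0]
        by eventually_elim (use close in \<open>simp add: norm_minus_commute\<close>)
      show "((\<lambda>X. 1 / X) \<longlongrightarrow> 0) (at_top :: real filter)"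
        by (intro tendsto_divide_0[OF tendsto_const] filterlim_at_top_imp_at_infinity filterlim_ident)
    qed
    thus "(fresnel \<longlongrightarrow> \<kappa>) at_top" by (simp add: LIM_zero_iff)
    have "((\<lambda>v. 1 - v ^ 4 / 2) has_integral ((5/4) - (5/4) ^ 5 / 10) - (0 - 0 ^ 5 / 10)) {0..5/4::real}"
      by (rule fundamental_theorem_of_calculus)
        (auto intro!: derivative_eq_intros simp: has_real_derivative_iff_has_vector_derivative[symmetric])
    moreover have "((\<lambda>v. Re (cis (v\<^sup>2))) has_integral Re (fresnel (5/4))) {0..5/4}"
      unfolding fresnel_def by (intro has_integral_Re integrable_integral fresnel_integrable)
    moreover have "1 - v ^ 4 / 2 \<le> Re (cis (v\<^sup>2))" for v :: real
    proof -
      have "cos (2 * (v\<^sup>2 / 2)) = 1 - 2 * (sin (v\<^sup>2 / 2))\<^sup>2" by (rule cos_double_sin)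
      moreover have "\<bar>sin (v\<^sup>2 / 2)\<bar>\<^sup>2 \<le> \<bar>v\<^sup>2 / 2\<bar>\<^sup>2" by (intro power_mono abs_sin_x_le_abs_x) auto
      ultimately show ?thesis by (simp add: power_divide)
    qed
    ultimately have "((5/4) - (5/4) ^ 5 / 10) - (0 - 0 ^ 5 / 10) \<le> Re (fresnel (5/4))"
      by (rule has_integral_le) 
    hence "4 / 5 < Re (fresnel (5/4))" by (simp add: power_divide)
    also have "\<dots> \<le> cmod (fresnel (5/4))" by (rule complex_Re_le_cmod)
    finally show "\<kappa> \<noteq> 0" using close[of "5/4"] by auto
  qed
qed

text \<open>This is sqrt (pi / 8) * (1 + i). The final estimate divides by it, hence the
  nonvanishing clause.\<close>

definition fresnel_const :: complex where
  "fresnel_const = (SOME \<kappa>. \<kappa> \<noteq> 0 \<and> (fresnel \<longlongrightarrow> \<kappa>) at_top)"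

lemma fresnel_const: "fresnel_const \<noteq> 0" "(fresnel \<longlongrightarrow> fresnel_const) at_top"
  using someI_ex[of "\<lambda>\<kappa>. \<kappa> \<noteq> 0 \<and> (fresnel \<longlongrightarrow> \<kappa>) at_top"] fresnel_limit
  unfolding fresnel_const_def by blast+

lemma fresnel_scaled:
  assumes l: "0 < l" and X: "0 \<le> X"
  shows "integral {0..X} (\<lambda>u. cis (l * u\<^sup>2)) = fresnel (sqrt l * X) / of_real (sqrt l)"
proof -
  have "((\<lambda>x. sqrt l *\<^sub>R cis ((sqrt l * x)\<^sup>2)) has_integral (integral {sqrt l * 0..sqrt l * X} (\<lambda>v. cis (v\<^sup>2)))) {0..X}"
    by (rule has_integral_substitution[where c = 0 and d = "sqrt l * X"])
      (use l X in \<open>auto intro!: continuous_intros derivative_eq_intros mult_left_mono\<close>)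
  from integral_unique[OF this]
  have "integral {0..X} (\<lambda>x. sqrt l *\<^sub>R cis ((sqrt l * x)\<^sup>2)) = fresnel (sqrt l * X)"
    by (simp add: fresnel_def)
  thus ?thesis using l by (simp add: power_mult_distrib field_simps scaleR_conv_of_real)
qed

text \<open>Truncated at \<open>R\<close>, which makes it a Lebesgue integral. The spectral
  parameter \<open>l\<close> comes last so that \<open>subordination t R\<close> is a function on
  the spectrum.\<close>

definition subordination :: "real \<Rightarrow> real \<Rightarrow> real \<Rightarrow> complex" where
  "subordination t R l = (LINT r:{0..R}|lborel. cis (l * r\<^sup>2 + t\<^sup>2 / (4 * r\<^sup>2)))"

lemma subordination_integrable:
  "set_integrable lborel {a..b} (\<lambda>r. cis (l * r\<^sup>2 + t\<^sup>2 / (4 * r\<^sup>2)))"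
  unfolding set_integrable_def
proof (rule integrableI_bounded_set_indicator[where B = 1])
  have "cis \<in> borel_measurable borel"
    by (intro borel_measurable_continuous_onI continuous_on_cis continuous_on_id)
  from measurable_compose[OF _ this, of "\<lambda>r. l * r\<^sup>2 + t\<^sup>2 / (4 * r\<^sup>2)" lborel]
  show "(\<lambda>r. cis (l * r\<^sup>2 + t\<^sup>2 / (4 * r\<^sup>2))) \<in> borel_measurable lborel" by measurable
qed (auto simp: emeasure_lborel_Icc_eq)

text \<open>The phase is t sqrt l + l (r - c / r)^2, invariant under the inversion r -> c / r. The
  lower limit \<open>c / R\<close> makes the interval invariant too; folding it at the fixed point
  sqrt c gives the weight 1 + c / u^2, the derivative of u - c / u.\<close>

lemma subordination_core:
  assumes l: "0 < l" and t: "0 < t" and c: "c = t / (2 * sqrt l)" and R: "sqrt c \<le> R"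
  shows "integral {c / R..R} (\<lambda>r. cis (l * r\<^sup>2 + t\<^sup>2 / (4 * r\<^sup>2))) =
    cis (t * sqrt l) * integral {0..R - c / R} (\<lambda>u. cis (l * u\<^sup>2))"
proof -
  define q where "q = sqrt c"
  have c0: "0 < c" using l t c by simp
  have q: "0 < q" "q * q = c" "q \<le> R" using c0 R by (auto simp: q_def)
  have R0: "0 < R" using q by linarith
  have cR: "c / R \<le> q" using q R0 mult_left_mono[OF q(3), of q] by (simp add: field_simps)
  have cq: "c / q = q" using q by (simp add: field_simps)
  define g where "g r = cis (l * (r - c / r)\<^sup>2)" for r
  have cg: "continuous_on S g" if "\<And>x. x \<in> S \<Longrightarrow> 0 < x" for S
    unfolding g_def by (intro continuous_intros) (use that in force)
  have pos: "0 < c / R" using c0 R0 by simp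
  have ig: "g integrable_on {x..y}" if "0 < x" for x y
    by (intro integrable_continuous_real cg) (use that in auto)
  have phase: "cis (l * r\<^sup>2 + t\<^sup>2 / (4 * r\<^sup>2)) = cis (t * sqrt l) * g r" if "0 < r" for r
  proof -
    have "l * c\<^sup>2 = t\<^sup>2 / 4" using l by (simp add: c power_divide power_mult_distrib)
    moreover have "2 * l * c = t * sqrt l" using l by (simp add: c real_div_sqrt field_simps)
    moreover have "l * (r - c / r)\<^sup>2 = l * r\<^sup>2 + l * c\<^sup>2 / r\<^sup>2 - 2 * l * c"
      using that by (simp add: power2_eq_square field_simps)
    moreover have "l * c\<^sup>2 / r\<^sup>2 = t\<^sup>2 / (4 * r\<^sup>2)" unfolding \<open>l * c\<^sup>2 = t\<^sup>2 / 4\<close> by simp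
    ultimately have "l * r\<^sup>2 + t\<^sup>2 / (4 * r\<^sup>2) = t * sqrt l + l * (r - c / r)\<^sup>2" by simp
    thus ?thesis by (simp add: g_def cis_mult)
  qed
  have sym: "g (c / u) = g u" if "0 < u" for u
    unfolding g_def using c0 that by (simp add: power2_commute)
  have "((\<lambda>u. (- c / u\<^sup>2) *\<^sub>R g (c / u)) has_integral (integral {c / q..c / R} g - integral {c / R..c / q} g)) {q..R}"
  proof (rule has_integral_substitution_general[where s = "{}" and c = "c / R" and d = q])
    have "c / R \<le> c / u \<and> c / u \<le> q" if "q \<le> u" "u \<le> R" for u
    proof
      have u: "0 < u" using that q by linarith
      show "c / R \<le> c / u" using that c0 R0 u by (intro divide_left_mono) auto
      show "c / u \<le> q" using mult_left_mono[OF that(1), of q] q u by (simp add: pos_divide_le_eq)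
    qed
    thus "(\<lambda>u. c / u) ` {q..R} \<subseteq> {c / R..q}" by auto
    show "continuous_on {c / R..q} g" by (rule cg) (use pos in auto)
    show "continuous_on {q..R} (\<lambda>u. c / u)" by (intro continuous_intros) (use q in auto)
    fix u assume "u \<in> {q..R} - {}"
    hence "u \<noteq> 0" using q by auto
    thus "((\<lambda>u. c / u) has_real_derivative - c / u\<^sup>2) (at u within {q..R})"
      by (auto intro!: derivative_eq_intros simp: power2_eq_square)
  qed (use q in auto)
  \<comment> \<open>The inversion reverses orientation, so the general substitution rule returns a
    difference; since c / q = q >= c / R, this half has at most one point.\<close>
  moreover have "integral {c / q..c / R} g = 0" using cR cq by (cases "c / R = q") auto
  ultimately have "((\<lambda>u. - ((c / u\<^sup>2) *\<^sub>R g (c / u))) has_integral - integral {c / R..q} g) {q..R}" by (simp add: cq)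
  from has_integral_neg[OF this] have "((\<lambda>u. (c / u\<^sup>2) *\<^sub>R g (c / u)) has_integral integral {c / R..q} g) {q..R}" by simp
  hence "((\<lambda>u. (c / u\<^sup>2) *\<^sub>R g u) has_integral integral {c / R..q} g) {q..R}"
    by (rule has_integral_eq[rotated]) (use q sym in auto)
  from has_integral_add[OF this integrable_integral[OF ig[OF q(1)]]]
  have "((\<lambda>u. (c / u\<^sup>2) *\<^sub>R g u + g u) has_integral integral {c / R..q} g + integral {q..R} g) {q..R}" .
  moreover have "integral {c / R..q} g + integral {q..R} g = integral {c / R..R} g"
    by (rule Henstock_Kurzweil_Integration.integral_combine[OF cR q(3) ig[OF pos]])
  ultimately have A: "((\<lambda>u. (1 + c / u\<^sup>2) *\<^sub>R g u) has_integral integral {c / R..R} g) {q..R}"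
    by (simp add: scaleR_add_left add.commute)
  have "((\<lambda>u. (1 + c / u\<^sup>2) *\<^sub>R cis (l * (u - c / u)\<^sup>2)) has_integral
      (integral {q - c / q..R - c / R} (\<lambda>w. cis (l * w\<^sup>2)))) {q..R}"
  proof (rule has_integral_substitution[where c = 0 and d = "R - c / R"])
    have mono: "x - c / x \<le> y - c / y" if "q \<le> x" "x \<le> y" for x y
      using that q c0 by (intro diff_mono divide_left_mono) auto
    show "q - c / q \<le> R - c / R" using mono q by simp
    show "(\<lambda>u. u - c / u) ` {q..R} \<subseteq> {0..R - c / R}"
      using mono[of q] mono[of _ R] cq by auto
    show "continuous_on {0..R - c / R} (\<lambda>w. cis (l * w\<^sup>2))" by (intro continuous_intros)
    fix u assume "u \<in> {q..R}"
    hence "u \<noteq> 0" using q by auto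
    thus "((\<lambda>u. u - c / u) has_real_derivative 1 + c / u\<^sup>2) (at u within {q..R})"
      by (auto intro!: derivative_eq_intros simp: power2_eq_square)
  qed (use q in auto)
  hence "integral {c / R..R} g = integral {0..R - c / R} (\<lambda>w. cis (l * w\<^sup>2))"
    using A cq unfolding g_def[symmetric] by (metis diff_self has_integral_unique)
  moreover have "integral {c / R..R} (\<lambda>r. cis (l * r\<^sup>2 + t\<^sup>2 / (4 * r\<^sup>2))) = integral {c / R..R} (\<lambda>r. cis (t * sqrt l) * g r)"
    by (rule Henstock_Kurzweil_Integration.integral_cong) (use pos phase in auto)
  ultimately show ?thesis by simp
qed

text \<open>The error is the integral over [0, c / R] of a function of modulus one.\<close>

lemma subordination_approx:
  assumes l: "0 < l" and t: "0 < t" and c: "c = t / (2 * sqrt l)" and R: "sqrt c \<le> R"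
  shows "cmod (subordination t R l - cis (t * sqrt l) * (fresnel (sqrt l * (R - c / R)) / of_real (sqrt l))) \<le> c / R"
proof -
  define f where "f r = cis (l * r\<^sup>2 + t\<^sup>2 / (4 * r\<^sup>2))" for r
  have c0: "0 < c" using l t c by simp
  have R0: "0 < R" using R c0 real_sqrt_gt_zero[OF c0] by linarith
  have "(sqrt c)\<^sup>2 \<le> R\<^sup>2" using R c0 by (intro power_mono) auto
  hence cR: "c / R \<le> R" using c0 R0 by (simp add: field_simps power2_eq_square)
  have i: "f integrable_on {a..b}" for a b
    using set_borel_integral_eq_integral(1)[OF subordination_integrable[of a b l t]] unfolding f_def[abs_def] .
  have "subordination t R l = integral {0..R} f"
    unfolding subordination_def f_def by (rule set_borel_integral_eq_integral(2)[OF subordination_integrable])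
  also have "\<dots> = integral {0..c / R} f + integral {c / R..R} f"
    by (rule Henstock_Kurzweil_Integration.integral_combine[symmetric]) (use c0 R0 cR i in auto)
  also have "integral {c / R..R} f = cis (t * sqrt l) * (fresnel (sqrt l * (R - c / R)) / of_real (sqrt l))"
    unfolding f_def by (subst subordination_core[OF l t c R], subst fresnel_scaled[OF l]) (use cR in auto)
  finally have "cmod (subordination t R l - cis (t * sqrt l) * (fresnel (sqrt l * (R - c / R)) / of_real (sqrt l))) = cmod (integral {0..c / R} f)"
    by simp
  also have "\<dots> \<le> integral {0..c / R} (\<lambda>_. 1)"
    by (rule integral_norm_bound_integral[OF i]) (auto simp: f_def)
  also have "\<dots> = c / R" using c0 R0 by simp
  finally show ?thesis .
qed

text \<open>Serves as the majorant in the limit R -> infinity: with l = omega^2 it is a multiple of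
  1 / omega, uniformly in \<open>R\<close>.\<close>

lemma subordination_bound:
  assumes l: "0 < l" and t: "0 < t" and R: "1 \<le> R"
  shows "cmod (subordination t R l) \<le> (2 + t) / sqrt l"
proof -
  define c where "c = t / (2 * sqrt l)"
  have c0: "0 < c" using l t by (simp add: c_def)
  have c2: "c \<le> t / sqrt l" using l t by (simp add: c_def field_simps)
  show ?thesis
  proof (cases "sqrt c \<le> R")
    case True
    have "(sqrt c)\<^sup>2 \<le> R\<^sup>2" using True c0 by (intro power_mono) auto
    hence cR: "c / R \<le> R" using c0 R by (simp add: field_simps power2_eq_square)
    define X where "X = cis (t * sqrt l) * (fresnel (sqrt l * (R - c / R)) / of_real (sqrt l))"
    have "cmod X \<le> 2 / sqrt l"
      unfolding X_def using fresnel_bound[of "sqrt l * (R - c / R)"] l cR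
      by (simp add: norm_mult norm_divide divide_right_mono)
    moreover have "cmod (subordination t R l - X) \<le> c / R"
      unfolding X_def by (rule subordination_approx[OF l t c_def True])
    moreover have "c / R \<le> c" using c0 R by (simp add: field_simps)
    ultimately have "cmod (subordination t R l) \<le> 2 / sqrt l + t / sqrt l"
      using norm_triangle_sub[of "subordination t R l" X] c2 by linarith
    thus ?thesis by (simp add: add_divide_distrib)
  next
    case False
    \<comment> \<open>Before the fixed point sqrt c is reached the trivial bound R suffices, as R >=
      1 gives R <= R^2 <= c.\<close>
    have "R * 1 \<le> R * R" using R by (intro mult_left_mono) auto
    also have "R * R \<le> sqrt c * sqrt c" using False R c0 by (intro mult_mono) auto
    finally have "R \<le> c" using c0 by simp
    have "cmod (subordination t R l) = cmod (integral {0..R} (\<lambda>r. cis (l * r\<^sup>2 + t\<^sup>2 / (4 * r\<^sup>2))))"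
      unfolding subordination_def by (simp add: set_borel_integral_eq_integral(2)[OF subordination_integrable])
    also have "\<dots> \<le> integral {0..R} (\<lambda>_. 1)"
      by (rule integral_norm_bound_integral)
        (use set_borel_integral_eq_integral(1)[OF subordination_integrable] in auto)
    also have "\<dots> = R" using R by simp
    also have "\<dots> \<le> t / sqrt l" using \<open>R \<le> c\<close> c2 by linarith
    also have "\<dots> \<le> (2 + t) / sqrt l" using l t by (simp add: divide_right_mono)
    finally show ?thesis .
  qed
qed

lemma subordination_tendsto:
  assumes l: "0 < l" and t: "0 < t"
  shows "((\<lambda>R. subordination t R l) \<longlongrightarrow> fresnel_const * (cis (t * sqrt l) / of_real (sqrt l))) at_top"
proof -
  define c where "c = t / (2 * sqrt l)"
  define X where "X R = cis (t * sqrt l) * (fresnel (sqrt l * (R - c / R)) / of_real (sqrt l))" for R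
  have cR0: "((\<lambda>R. c / R) \<longlongrightarrow> 0) at_top"
    by (intro tendsto_divide_0[OF tendsto_const] filterlim_at_top_imp_at_infinity filterlim_ident)
  have "filterlim (\<lambda>R. sqrt l * (R - c / R)) at_top at_top"
  proof (rule filterlim_tendsto_pos_mult_at_top[OF tendsto_const])
    show "0 < sqrt l" using l by simp
    have "filterlim (\<lambda>R. - (c / R) + R) at_top at_top"
      by (rule filterlim_tendsto_add_at_top[OF tendsto_minus[OF cR0] filterlim_ident])
    thus "filterlim (\<lambda>R. R - c / R) at_top at_top" by simp
  qed
  from filterlim_compose[OF fresnel_const(2) this]
  have "(X \<longlongrightarrow> cis (t * sqrt l) * (fresnel_const / of_real (sqrt l))) at_top"
    unfolding X_def[abs_def] by (intro tendsto_intros) (use l in auto)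
  moreover have "((\<lambda>R. subordination t R l - X R) \<longlongrightarrow> 0) at_top"
  proof (rule Lim_null_comparison[OF _ cR0])
    show "\<forall>\<^sub>F R in at_top. cmod (subordination t R l - X R) \<le> c / R"
      using eventually_ge_at_top[of "sqrt c"]
      by eventually_elim (unfold X_def, rule subordination_approx[OF l t c_def])
  qed
  ultimately have "((\<lambda>R. X R + (subordination t R l - X R)) \<longlongrightarrow> cis (t * sqrt l) * (fresnel_const / of_real (sqrt l)) + 0) at_top"
    by (rule tendsto_add)
  thus ?thesis by (simp add: mult_ac)
qed

section \<open>Spectral integrals over the torus\<close>

lemma cis_borel_measurable [measurable]: "cis \<in> borel_measurable borel"
  by (intro borel_measurable_continuous_onI continuous_on_cis continuous_on_id)

lemma vec_nth_borel_measurable [measurable]: "(\<lambda>\<xi>::real^'n. \<xi> $ j) \<in> borel_measurable borel"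
  by (intro borel_measurable_continuous_onI continuous_intros)

text \<open>Lebesgue measure is the image of a product measure indexed by basis vectors; the work is
  to reindex these by the coordinates through \<open>axis\<close>.\<close>

lemma prod_coordinates_lborel:
  fixes f :: "'n::finite \<Rightarrow> real \<Rightarrow> 'b::{real_normed_field,banach,second_countable_topology}"
  assumes f: "\<And>j. integrable lborel (f j)"
  shows "integrable lborel (\<lambda>\<xi>::real^'n. \<Prod>j\<in>UNIV. f j (\<xi> $ j))"
    and "integral\<^sup>L lborel (\<lambda>\<xi>::real^'n. \<Prod>j\<in>UNIV. f j (\<xi> $ j)) = (\<Prod>j\<in>UNIV. integral\<^sup>L lborel (f j))"
proof -
  define e where "e j = (axis j 1 :: real^'n)" for j
  have inj: "inj e" by (auto simp: inj_def e_def axis_eq_axis)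
  have B: "(Basis :: (real^'n) set) = range e" by (auto simp: Basis_vec_def e_def)
  define F where "F b = f (inv e b)" for b
  have Fe: "F (e j) = f j" for j by (simp add: F_def inj)
  define h where "h = (\<lambda>\<omega>. \<Sum>b\<in>(Basis :: (real^'n) set). \<omega> b *\<^sub>R b :: real^'n)"
  have lb: "(lborel :: (real^'n) measure) = distr (\<Pi>\<^sub>M b\<in>Basis. lborel) borel h"
    unfolding lborel_def[where 'a = "real^'n"] lborel_eq_real[symmetric] h_def ..
  have hm [measurable]: "h \<in> measurable (\<Pi>\<^sub>M b\<in>Basis. lborel) borel"
    unfolding h_def by measurable
  have hn: "h \<omega> $ j = \<omega> (e j)" for \<omega> j
  proof -
    have "h \<omega> $ j = (\<Sum>i\<in>UNIV. \<omega> (e i) * (e i $ j))"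
      unfolding h_def B by (subst sum.reindex[OF inj]) simp
    also have "\<dots> = (\<Sum>i\<in>UNIV. if i = j then \<omega> (e i) else 0)"
      by (intro sum.cong) (auto simp: e_def axis_def)
    finally show ?thesis by simp
  qed
  have eq: "(\<Prod>j\<in>UNIV. f j (h \<omega> $ j)) = (\<Prod>b\<in>Basis. F b (\<omega> b))" for \<omega>
    unfolding hn B by (subst prod.reindex[OF inj]) (simp add: Fe)
  have fm [measurable]: "f j \<in> borel_measurable borel" for j using f[of j] by auto
  have m: "(\<lambda>\<xi>::real^'n. \<Prod>j\<in>UNIV. f j (\<xi> $ j)) \<in> borel_measurable borel" by measurable
  interpret P: product_sigma_finite "\<lambda>_::real^'n. lborel :: real measure"
    by (rule product_sigma_finite.intro) (rule sigma_finite_lborel)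
  have F: "integrable lborel (F b)" if "b \<in> Basis" for b using f by (simp add: F_def)
  show "integrable lborel (\<lambda>\<xi>::real^'n. \<Prod>j\<in>UNIV. f j (\<xi> $ j))"
    unfolding lb integrable_distr_eq[OF hm m] eq
    by (rule P.product_integrable_prod) (use F in auto)
  have "integral\<^sup>L lborel (\<lambda>\<xi>::real^'n. \<Prod>j\<in>UNIV. f j (\<xi> $ j)) = (\<Prod>b\<in>Basis. integral\<^sup>L lborel (F b))"
    unfolding lb integral_distr[OF hm m] eq
    by (rule P.product_integral_prod) (use F in auto)
  also have "\<dots> = (\<Prod>j\<in>UNIV. integral\<^sup>L lborel (f j))"
    unfolding B by (subst prod.reindex[OF inj]) (simp add: Fe)
  finally show "integral\<^sup>L lborel (\<lambda>\<xi>::real^'n. \<Prod>j\<in>UNIV. f j (\<xi> $ j)) = (\<Prod>j\<in>UNIV. integral\<^sup>L lborel (f j))" .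
qed

lemma mem_torus4: "\<xi> \<in> torus4 \<longleftrightarrow> (\<forall>j. \<xi> $ j \<in> {-pi..pi})"
  by (auto simp: torus4_def mem_box_cart)

lemma indicator_torus4: "indicator torus4 \<xi> = (\<Prod>j\<in>UNIV. indicator {-pi..pi} (\<xi> $ j) :: 'a::comm_semiring_1)"
proof (cases "\<xi> \<in> torus4")
  case True
  thus ?thesis by (auto simp: mem_torus4 indicator_def)
next
  case False
  then obtain j where "\<xi> $ j \<notin> {-pi..pi}" by (auto simp: mem_torus4)
  hence "(\<Prod>j\<in>UNIV. indicator {-pi..pi} (\<xi> $ j) :: 'a) = 0"
    by (intro prod_zero) (auto simp: indicator_def)
  thus ?thesis using False by simp
qed

lemma torus4_measurable [measurable]: "torus4 \<in> sets borel"
  by (simp add: torus4_def)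

lemma torus4_finite: "emeasure lborel torus4 < \<infinity>"
  unfolding torus4_def by (rule emeasure_bounded_finite[OF bounded_cbox])

lemma omega_measurable [measurable]: "omega \<in> borel_measurable borel"
  unfolding omega_def[abs_def] by measurable

lemma omega_nonneg: "0 \<le> omega \<xi>"
  unfolding omega_def by (intro real_sqrt_ge_zero sum_nonneg) simp

lemma omega_squared: "(omega \<xi>)\<^sup>2 = (\<Sum>j\<in>UNIV. 2 - 2 * cos (\<xi> $ j))"
  unfolding omega_def by (intro real_sqrt_pow2 sum_nonneg) simp

text \<open>2 - 2 cos y = 4 sin (y / 2)^2 is at least 4 (y / 6)^2 = (y / 3)^2. A bound by single
  coordinates, not by the norm, is what a product majorant needs.\<close>

lemma omega_ge:
  assumes "\<xi> \<in> torus4"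
  shows "\<bar>\<xi> $ j\<bar> / 3 \<le> omega \<xi>"
proof (rule power2_le_imp_le[OF _ omega_nonneg])
  define y where "y = \<bar>\<xi> $ j\<bar>"
  have "\<xi> $ j \<in> {-pi..pi}" using assms by (simp add: mem_torus4)
  hence y: "0 \<le> y" "y \<le> pi" by (auto simp: y_def)
  have "y / 2 / 3 \<le> sin (y / 2)" using y by (intro sin_ge_third) auto
  hence "(y / 2 / 3)\<^sup>2 \<le> (sin (y / 2))\<^sup>2" using y by (intro power_mono) auto
  hence "(y / 3)\<^sup>2 \<le> 2 - 2 * cos y" using cos_double_sin[of "y / 2"] by (simp add: power_divide)
  also have "\<dots> = 2 - 2 * cos (\<xi> $ j)" by (simp add: y_def)
  also have "\<dots> \<le> (omega \<xi>)\<^sup>2" unfolding omega_squared by (rule member_le_sum) auto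
  finally show "(\<bar>\<xi> $ j\<bar> / 3)\<^sup>2 \<le> (omega \<xi>)\<^sup>2" by (simp add: y_def)
qed

lemma powr_quarter_integrable:
  "integrable lborel (\<lambda>x. indicator {-pi..pi} x * \<bar>x\<bar> powr (- 1 / 4) :: real)"
proof -
  define h where "h x = indicator {0..pi} x * x powr (- 1 / 4)" for x :: real
  have [measurable]: "h \<in> borel_measurable borel" unfolding h_def[abs_def] by measurable
  have h0: "0 \<le> h x" for x by (simp add: h_def indicator_def)
  obtain I where "((\<lambda>x. x powr (- 1 / 4)) has_integral I) {0..pi}"
    using has_integral_powr_from_0[of "- 1 / 4" pi] by auto
  hence "((\<lambda>x. if x \<in> {0..pi} then x powr (- 1 / 4) else 0) has_integral I) UNIV"
    by (simp only: has_integral_restrict_UNIV)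
  moreover have "(\<lambda>x. if x \<in> {0..pi} then x powr (- 1 / 4) else 0) = h"
    by (auto simp: h_def fun_eq_iff indicator_def)
  ultimately have "integral\<^sup>N lborel h = I"
    by (intro nn_integral_has_integral_lborel) (use h0 in auto)
  hence "integrable lborel h" by (intro integrableI_nonneg) (use h0 in auto)
  moreover from lborel_integrable_real_affine[OF this, of "-1" 0]
  have "integrable lborel (\<lambda>x. h (- x))" by simp
  ultimately have "integrable lborel (\<lambda>x. h x + h (- x))" by (rule Bochner_Integration.integrable_add)
  moreover have "h x + h (- x) = indicator {-pi..pi} x * \<bar>x\<bar> powr (- 1 / 4)" for x
    by (auto simp: h_def indicator_def)
  ultimately show ?thesis by simp
qed

lemma AE_coordinates_nonzero: "AE \<xi> in lborel. \<forall>j. (\<xi> :: real^'n) $ j \<noteq> 0"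
proof -
  have "AE \<xi> in lborel. (\<xi> :: real^'n) $ j \<noteq> 0" for j
  proof (rule AE_I')
    have m: "{\<xi> :: real^'n. \<xi> $ j = 0} \<in> sets lborel" by measurable
    have "negligible {\<xi> :: real^'n. \<xi> $ j = 0}" by (rule negligible_standard_hyperplane_cart)
    thus "{\<xi> :: real^'n. \<xi> $ j = 0} \<in> null_sets lborel"
      using null_sets_completion_iff[OF m] by (simp add: negligible_iff_null_sets)
  qed auto
  thus ?thesis by (simp add: AE_all_countable)
qed

text \<open>The geometric mean of the four coordinate bounds majorizes 1 / omega by a product of
  powers |\<xi>_j|^(-1/4), each integrable on its own, so no polar coordinates are involved.\<close>

lemma inverse_omega_integrable: "integrable lborel (\<lambda>\<xi>. indicator torus4 \<xi> * (1 / omega \<xi>))"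
proof -
  define f where "f x = 3 powr (1 / 4) * (indicator {-pi..pi} x * \<bar>x\<bar> powr (- 1 / 4))" for x :: real
  have "integrable lborel (\<lambda>\<xi>::real^4. \<Prod>j\<in>UNIV. f (\<xi> $ j))"
    by (rule prod_coordinates_lborel(1)) (simp only: f_def[abs_def] powr_quarter_integrable integrable_mult_right)
  thus ?thesis
  proof (rule Bochner_Integration.integrable_bound)
    show "(\<lambda>\<xi>. indicator torus4 \<xi> * (1 / omega \<xi>)) \<in> borel_measurable lborel" by measurable
    show "AE \<xi> in lborel. norm (indicator torus4 \<xi> * (1 / omega \<xi>)) \<le> norm (\<Prod>j\<in>UNIV. f (\<xi> $ j))"
      \<comment> \<open>The coordinate hyperplanes must be excluded: there
        \<open>0 powr (- 1 / 4) = 0\<close> makes the majorant vanish.\<close>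
      using AE_coordinates_nonzero
    proof eventually_elim
      case (elim \<xi>)
      show ?case
      proof (cases "\<xi> \<in> torus4")
        case True
        have pos: "0 < omega \<xi>" using omega_ge[OF True, of undefined] elim
          by (smt (verit) divide_pos_pos zero_less_abs_iff)
        have le: "(1 / omega \<xi>) powr (1 / 4) \<le> f (\<xi> $ j)" for j
        proof -
          have y: "0 < \<bar>\<xi> $ j\<bar>" using elim by auto
          have "1 / omega \<xi> \<le> 3 / \<bar>\<xi> $ j\<bar>"
            using omega_ge[OF True, of j] pos y by (simp add: field_simps)
          hence "(1 / omega \<xi>) powr (1 / 4) \<le> (3 / \<bar>\<xi> $ j\<bar>) powr (1 / 4)"
            using pos by (intro powr_mono2) auto
          also have "\<dots> = 3 powr (1 / 4) * \<bar>\<xi> $ j\<bar> powr (- 1 / 4)"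
            using y by (simp add: powr_divide powr_minus field_simps)
          also have "\<dots> = f (\<xi> $ j)" using True by (simp add: f_def mem_torus4)
          finally show ?thesis .
        qed
        have "1 / omega \<xi> = ((1 / omega \<xi>) powr (1 / 4)) ^ 4"
          using pos by (simp add: powr_power)
        also have "\<dots> = (\<Prod>j\<in>(UNIV::4 set). (1 / omega \<xi>) powr (1 / 4))" by simp
        also have "\<dots> \<le> (\<Prod>j\<in>UNIV. f (\<xi> $ j))" by (intro prod_mono) (use le in auto)
        finally show ?thesis using True pos by simp
      qed simp
    qed
  qed
qed

abbreviation pairing :: "int ^ 4 \<Rightarrow> real ^ 4 \<Rightarrow> real" where
  "pairing x \<xi> \<equiv> (\<Sum>j\<in>UNIV. real_of_int (x $ j) * \<xi> $ j)"

lemma cis_sum: "finite A \<Longrightarrow> cis (\<Sum>j\<in>A. f j) = (\<Prod>j\<in>A. cis (f j))"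
  by (induction A rule: finite_induct) (auto simp: cis_mult[symmetric])

lemma lattice_kernel_eq_integral:
  "(LINT \<xi>:torus4|lborel. cis (pairing x \<xi> + s * (omega \<xi>)\<^sup>2)) = lattice_kernel x s"
proof -
  define f where "f j y = indicator {-pi..pi} y *\<^sub>R cis (of_int (x $ j) * y + s * (2 - 2 * cos y))" for j and y :: real
  have i: "set_integrable lborel {-pi..pi} (\<lambda>y. cis (of_int (x $ j) * y + s * (2 - 2 * cos y)))" for j
    by (intro borel_integrable_atLeastAtMost' continuous_intros)
  have fi: "integrable lborel (f j)" for j using i[of j] unfolding f_def[abs_def] set_integrable_def .
  have eq: "indicator torus4 \<xi> *\<^sub>R cis (pairing x \<xi> + s * (omega \<xi>)\<^sup>2) = (\<Prod>j\<in>UNIV. f j (\<xi> $ j))" for \<xi>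
  proof -
    have "cis (pairing x \<xi> + s * (omega \<xi>)\<^sup>2) = (\<Prod>j\<in>UNIV. cis (of_int (x $ j) * \<xi> $ j + s * (2 - 2 * cos (\<xi> $ j))))"
      unfolding omega_squared sum_distrib_left sum.distrib[symmetric] by (rule cis_sum) simp
    thus ?thesis by (simp add: f_def scaleR_conv_of_real prod.distrib indicator_torus4)
  qed
  have "integral\<^sup>L lborel (f j) = schrodinger_kernel (x $ j) s" for j
    using set_borel_integral_eq_integral(2)[OF i[of j]]
    unfolding f_def[abs_def] schrodinger_kernel_def set_lebesgue_integral_def .
  thus ?thesis unfolding set_lebesgue_integral_def eq prod_coordinates_lborel(2)[OF fi] lattice_kernel_def by simp
qed

lemma subordination_measurable [measurable]: "subordination t R \<in> borel_measurable borel"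
  unfolding subordination_def[abs_def] set_lebesgue_integral_def by measurable

text \<open>Truncation makes Fubini immediate: the integrand has modulus at most one on a set of
  finite measure.\<close>

lemma spectral_integral_eq:
  "(LINT \<xi>:torus4|lborel. cis (pairing x \<xi>) * subordination t R ((omega \<xi>)\<^sup>2)) =
   (LINT r:{0..R}|lborel. cis (t\<^sup>2 / (4 * r\<^sup>2)) * lattice_kernel x (r\<^sup>2))"
proof -
  define g where "g \<xi> r = indicator torus4 \<xi> *\<^sub>R (indicator {0..R} r *\<^sub>R
    cis (pairing x \<xi> + (omega \<xi>)\<^sup>2 * r\<^sup>2 + t\<^sup>2 / (4 * r\<^sup>2)))" for \<xi> r
  have "case_prod g = (\<lambda>p. indicator (torus4 \<times> {0..R}) p *\<^sub>R
      cis (pairing x (fst p) + (omega (fst p))\<^sup>2 * (snd p)\<^sup>2 + t\<^sup>2 / (4 * (snd p)\<^sup>2)))"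
    by (auto simp: g_def fun_eq_iff indicator_def)
  moreover have "integrable (lborel \<Otimes>\<^sub>M lborel) \<dots>"
  proof (rule integrableI_bounded_set_indicator[where B = 1])
    show "torus4 \<times> {0..R} \<in> sets (lborel \<Otimes>\<^sub>M lborel)" by simp
    have "emeasure (lborel \<Otimes>\<^sub>M lborel) (torus4 \<times> {0..R}) = emeasure lborel torus4 * emeasure lborel {0..R}"
      by (rule lborel.emeasure_pair_measure_Times) auto
    also have "\<dots> < \<infinity>" using torus4_finite by (simp add: ennreal_mult_less_top emeasure_lborel_Icc_eq)
    finally show "emeasure (lborel \<Otimes>\<^sub>M lborel) (torus4 \<times> {0..R}) < \<infinity>" .
  qed auto
  ultimately have gi: "integrable (lborel \<Otimes>\<^sub>M lborel) (case_prod g)" by simp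
  have "(LINT \<xi>:torus4|lborel. cis (pairing x \<xi>) * subordination t R ((omega \<xi>)\<^sup>2)) = (LINT \<xi>|lborel. LINT r|lborel. g \<xi> r)"
    unfolding set_lebesgue_integral_def subordination_def
  proof (rule Bochner_Integration.integral_cong[OF refl])
    fix \<xi>
    have "g \<xi> r = (indicator torus4 \<xi> *\<^sub>R cis (pairing x \<xi>)) * (indicator {0..R} r *\<^sub>R cis ((omega \<xi>)\<^sup>2 * r\<^sup>2 + t\<^sup>2 / (4 * r\<^sup>2)))" for r
      by (simp add: g_def cis_mult add.assoc)
    hence "(LINT r|lborel. g \<xi> r) = (indicator torus4 \<xi> *\<^sub>R cis (pairing x \<xi>)) *
        (LINT r|lborel. indicator {0..R} r *\<^sub>R cis ((omega \<xi>)\<^sup>2 * r\<^sup>2 + t\<^sup>2 / (4 * r\<^sup>2)))"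
      by (simp only: integral_mult_right_zero)
    thus "indicator torus4 \<xi> *\<^sub>R (cis (pairing x \<xi>) * (LINT r|lborel. indicator {0..R} r *\<^sub>R cis ((omega \<xi>)\<^sup>2 * r\<^sup>2 + t\<^sup>2 / (4 * r\<^sup>2))))
        = (LINT r|lborel. g \<xi> r)"
      by (simp only: mult_scaleR_left)
  qed
  also have "\<dots> = (LINT r|lborel. LINT \<xi>|lborel. g \<xi> r)"
    by (rule lborel_pair.Fubini_integral[OF gi, symmetric])
  also have "\<dots> = (LINT r:{0..R}|lborel. cis (t\<^sup>2 / (4 * r\<^sup>2)) * lattice_kernel x (r\<^sup>2))"
    unfolding set_lebesgue_integral_def
  proof (rule Bochner_Integration.integral_cong[OF refl])
    fix r
    have "g \<xi> r = (indicator {0..R} r *\<^sub>R cis (t\<^sup>2 / (4 * r\<^sup>2))) * (indicator torus4 \<xi> *\<^sub>R cis (pairing x \<xi> + r\<^sup>2 * (omega \<xi>)\<^sup>2))" for \<xi>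
      by (simp add: g_def cis_mult mult_ac add_ac)
    hence "(LINT \<xi>|lborel. g \<xi> r) = (indicator {0..R} r *\<^sub>R cis (t\<^sup>2 / (4 * r\<^sup>2))) *
        (LINT \<xi>|lborel. indicator torus4 \<xi> *\<^sub>R cis (pairing x \<xi> + r\<^sup>2 * (omega \<xi>)\<^sup>2))"
      by (simp only: integral_mult_right_zero)
    thus "(LINT \<xi>|lborel. g \<xi> r) = indicator {0..R} r *\<^sub>R (cis (t\<^sup>2 / (4 * r\<^sup>2)) * lattice_kernel x (r\<^sup>2))"
      using lattice_kernel_eq_integral[of x "r\<^sup>2"]
      by (simp only: mult_scaleR_left set_lebesgue_integral_def)
  qed
  finally show ?thesis .
qed

lemma spectral_integral_bound:
  assumes t: "0 < t" and R: "sqrt t \<le> R"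
  shows "cmod (LINT \<xi>:torus4|lborel. cis (pairing x \<xi>) * subordination t R ((omega \<xi>)\<^sup>2))
    \<le> bessel_const * (18 + 18 * ln (1 + 4 * t)) / sqrt t ^ 3"
proof -
  define f where "f r = cis (t\<^sup>2 / (4 * r\<^sup>2)) * lattice_kernel x (r\<^sup>2)" for r
  have T: "0 < sqrt t" using t by simp
  have [measurable]: "lattice_kernel x \<in> borel_measurable borel"
    by (intro borel_measurable_continuous_onI continuous_on_lattice_kernel)
  have "compact (lattice_kernel x ` {0..R\<^sup>2})"
    by (intro compact_continuous_image continuous_on_lattice_kernel compact_Icc)
  then obtain B where B: "\<And>s. s \<in> {0..R\<^sup>2} \<Longrightarrow> cmod (lattice_kernel x s) \<le> B"
    by (meson bounded_iff compact_imp_bounded imageI)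
  have "set_integrable lborel {0..R} f" unfolding set_integrable_def
  proof (rule integrableI_bounded_set_indicator[where B = B])
    show "AE r in lborel. r \<in> {0..R} \<longrightarrow> cmod (f r) \<le> B"
      using B by (auto simp: f_def norm_mult intro!: AE_I2 power_mono)
  qed (auto simp: f_def[abs_def] emeasure_lborel_Icc_eq)
  note F = set_borel_integral_eq_integral[OF this]
  have "(LINT \<xi>:torus4|lborel. cis (pairing x \<xi>) * subordination t R ((omega \<xi>)\<^sup>2)) = integral {0..R} f"
    unfolding spectral_integral_eq F(2)[symmetric] f_def ..
  also have "\<dots> = integral {0..sqrt t} f + integral {sqrt t..R} f"
    by (rule Henstock_Kurzweil_Integration.integral_combine[symmetric]) (use t R F(1) in auto)
  also have "cmod \<dots> \<le> bessel_const * (16 + 16 * ln (1 + 4 * t)) / sqrt t ^ 3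
      + 2 * bessel_const * (ln (1 + 4 * (sqrt t)\<^sup>2) + 1) / sqrt t ^ 3"
    by (intro order_trans[OF norm_triangle_ineq] add_mono)
      (unfold f_def, rule lattice_kernel_inner(2)[OF t], rule lattice_kernel_outer[OF T R])
  also have "\<dots> = bessel_const * (18 + 18 * ln (1 + 4 * t)) / sqrt t ^ 3"
    using t unfolding add_divide_distrib[symmetric] by (simp add: algebra_simps)
  finally show ?thesis .
qed

section \<open>The half-wave propagator as a limit of truncated superpositions\<close>

definition wave_integral :: "int ^ 4 \<Rightarrow> real \<Rightarrow> complex" where
  "wave_integral x t = (LINT \<xi>:torus4|lborel. cis (pairing x \<xi>) * (cis (t * omega \<xi>) / of_real (omega \<xi>)))"

lemma wave_integrable:
  "integrable lborel (\<lambda>\<xi>. indicator torus4 \<xi> *\<^sub>R (cis (pairing x \<xi>) * (cis (t * omega \<xi>) / of_real (omega \<xi>))))"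
  by (rule Bochner_Integration.integrable_bound[OF inverse_omega_integrable])
    (auto simp: norm_mult norm_divide omega_nonneg)

lemma wave_integral_bound:
  assumes t: "0 < t"
  shows "cmod (wave_integral x t) \<le> bessel_const / cmod fresnel_const * (18 + 18 * ln (1 + 4 * t)) / sqrt t ^ 3"
proof -
  define s where "s k \<xi> = indicator torus4 \<xi> *\<^sub>R (cis (pairing x \<xi>) * subordination t (real (Suc k)) ((omega \<xi>)\<^sup>2))" for k \<xi>
  define f where "f \<xi> = fresnel_const * (indicator torus4 \<xi> *\<^sub>R (cis (pairing x \<xi>) * (cis (t * omega \<xi>) / of_real (omega \<xi>))))" for \<xi>
  \<comment> \<open>The time \<open>t\<close> is fixed during the limit, so the growth of this
    majorant in \<open>t\<close> does not affect the estimate obtained.\<close>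
  define w where "w \<xi> = (2 + t) * (indicator torus4 \<xi> * (1 / omega \<xi>))" for \<xi>
  have pos: "AE \<xi> in lborel. \<xi> \<in> torus4 \<longrightarrow> 0 < omega \<xi>"
    using AE_coordinates_nonzero
  proof eventually_elim
    case (elim \<xi>)
    show ?case using omega_ge[of \<xi> undefined] elim by (smt (verit) divide_pos_pos zero_less_abs_iff)
  qed
  have "(\<lambda>k. integral\<^sup>L lborel (s k)) \<longlonglongrightarrow> integral\<^sup>L lborel f"
  proof (rule integral_dominated_convergence[where w = w])
    show "f \<in> borel_measurable lborel" unfolding f_def[abs_def] by measurable
    show "s k \<in> borel_measurable lborel" for k unfolding s_def[abs_def] by measurable
    show "integrable lborel w" unfolding w_def[abs_def]
      by (intro integrable_mult_right inverse_omega_integrable)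
    show "AE \<xi> in lborel. (\<lambda>k. s k \<xi>) \<longlonglongrightarrow> f \<xi>" using pos
    proof eventually_elim
      case (elim \<xi>)
      show ?case
      proof (cases "\<xi> \<in> torus4")
        case True
        hence o: "0 < omega \<xi>" using elim by simp
        have "filterlim (\<lambda>k. real (Suc k)) at_top sequentially"
          by (intro filterlim_compose[OF filterlim_real_sequentially] filterlim_Suc)
        from filterlim_compose[OF subordination_tendsto[OF _ t, of "(omega \<xi>)\<^sup>2"] this]
        have "(\<lambda>k. subordination t (real (Suc k)) ((omega \<xi>)\<^sup>2)) \<longlonglongrightarrow> fresnel_const * (cis (t * omega \<xi>) / of_real (omega \<xi>))"
          using o by simp
        from tendsto_mult_left[OF this, of "cis (pairing x \<xi>)"]
        show ?thesis using True by (simp add: s_def f_def mult_ac)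
      qed (simp add: s_def f_def)
    qed
    show "AE \<xi> in lborel. norm (s k \<xi>) \<le> w \<xi>" for k using pos
    proof eventually_elim
      case (elim \<xi>)
      show ?case
      proof (cases "\<xi> \<in> torus4")
        case True
        hence o: "0 < omega \<xi>" using elim by simp
        have "cmod (subordination t (real (Suc k)) ((omega \<xi>)\<^sup>2)) \<le> (2 + t) / sqrt ((omega \<xi>)\<^sup>2)"
          by (rule subordination_bound) (use o t in auto)
        thus ?thesis using True o by (simp add: s_def w_def norm_mult)
      qed (simp add: s_def w_def)
    qed
  qed
  hence "(\<lambda>k. cmod (integral\<^sup>L lborel (s k))) \<longlonglongrightarrow> cmod (integral\<^sup>L lborel f)" by (rule tendsto_norm)
  hence "cmod (integral\<^sup>L lborel f) \<le> bessel_const * (18 + 18 * ln (1 + 4 * t)) / sqrt t ^ 3"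
  proof (rule tendsto_upperbound)
    show "\<forall>\<^sub>F k in sequentially. cmod (integral\<^sup>L lborel (s k)) \<le> bessel_const * (18 + 18 * ln (1 + 4 * t)) / sqrt t ^ 3"
      using eventually_ge_at_top[of "nat \<lceil>sqrt t\<rceil>"]
    proof eventually_elim
      case (elim k)
      hence "sqrt t \<le> real (Suc k)" by linarith
      from spectral_integral_bound[OF t this, of x] show ?case
        unfolding s_def[abs_def] set_lebesgue_integral_def .
    qed
  qed simp
  moreover have "integral\<^sup>L lborel f = fresnel_const * wave_integral x t"
    unfolding f_def[abs_def] wave_integral_def set_lebesgue_integral_def by (rule integral_mult_right_zero)
  ultimately have "cmod (wave_integral x t) * cmod fresnel_const \<le> bessel_const * (18 + 18 * ln (1 + 4 * t)) / sqrt t ^ 3"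
    by (simp only: norm_mult mult.commute)
  hence "cmod (wave_integral x t) \<le> bessel_const * (18 + 18 * ln (1 + 4 * t)) / sqrt t ^ 3 / cmod fresnel_const"
    by (subst pos_le_divide_eq) (use fresnel_const(1) in auto)
  thus ?thesis by (simp add: mult.commute)
qed

text \<open>The sine is the difference of \<open>cis\<close> and its conjugate over 2 i. Conjugating
  the whole integral also conjugates the character, which the reflection of x undoes.\<close>

lemma G4_eq:
  "G4 x t = 1 / (2 * complex_of_real pi) ^ 4 * ((wave_integral x t - cnj (wave_integral (- x) t)) / (2 * \<i>))"
proof -
  define h where "h x \<xi> = indicator torus4 \<xi> *\<^sub>R (cis (pairing x \<xi>) * (cis (t * omega \<xi>) / of_real (omega \<xi>)))" for x \<xi>
  have hi: "integrable lborel (h x)" for x unfolding h_def[abs_def] by (rule wave_integrable)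
  have hw: "integral\<^sup>L lborel (h x) = wave_integral x t" for x
    unfolding h_def[abs_def] wave_integral_def set_lebesgue_integral_def ..
  have "indicator torus4 \<xi> *\<^sub>R (exp (\<i> * complex_of_real (pairing x \<xi>)) * complex_of_real (sin (t * omega \<xi>) / omega \<xi>))
      = (h x \<xi> - cnj (h (- x) \<xi>)) / (2 * \<i>)" for \<xi>
  proof -
    have p: "pairing (- x) \<xi> = - pairing x \<xi>" by (simp add: sum_negf)
    have 1: "complex_of_real (sin y) = (cis y - cnj (cis y)) / (2 * \<i>)" for y by (simp add: complex_eq_iff)
    have 2: "cnj (h (- x) \<xi>) = indicator torus4 \<xi> *\<^sub>R (cis (pairing x \<xi>) * (cnj (cis (t * omega \<xi>)) / of_real (omega \<xi>)))"
      by (simp only: h_def p complex_cnj_scaleR complex_cnj_mult complex_cnj_divide complex_cnj_complex_of_real cis_cnj minus_minus)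
    \<comment> \<open>Valid for v = 0 too, where both sides are 0; this covers the zero of
      omega.\<close>
    have 3: "u * ((z - w) / (2 * \<i>) / v) = (u * (z / v) - u * (w / v)) / (2 * \<i>)" for u v z w :: complex
      by (cases "v = 0") (auto simp: field_simps)
    show ?thesis unfolding 2 unfolding h_def of_real_divide 1 cis_conv_exp[symmetric] 3
      by (simp only: scaleR_diff_right scaleR_conv_of_real times_divide_eq_right right_diff_distrib)
  qed
  hence "(LINT \<xi>:torus4|lborel. exp (\<i> * complex_of_real (pairing x \<xi>)) * complex_of_real (sin (t * omega \<xi>) / omega \<xi>))
      = (LINT \<xi>|lborel. (h x \<xi> - cnj (h (- x) \<xi>)) / (2 * \<i>))"
    unfolding set_lebesgue_integral_def by simp
  also have "\<dots> = (integral\<^sup>L lborel (h x) - cnj (integral\<^sup>L lborel (h (- x)))) / (2 * \<i>)"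
    using hi by (simp add: Bochner_Integration.integral_diff)
  finally show ?thesis unfolding G4_def hw by (simp only:)
qed

lemma G4_large_time:
  assumes t: "0 < t"
  shows "cmod (G4 x t) \<le> bessel_const / cmod fresnel_const * (18 + 18 * ln (1 + 4 * t)) / sqrt t ^ 3"
proof -
  define M where "M = bessel_const / cmod fresnel_const * (18 + 18 * ln (1 + 4 * t)) / sqrt t ^ 3"
  have "cmod (wave_integral x t - cnj (wave_integral (- x) t)) \<le> M + M"
    unfolding M_def
    by (rule order_trans[OF norm_triangle_ineq4 add_mono]) (use wave_integral_bound[OF t] in auto)
  hence "cmod ((wave_integral x t - cnj (wave_integral (- x) t)) / (2 * \<i>)) \<le> M"
    by (simp add: norm_divide norm_mult)
  moreover have "cmod (1 / (2 * complex_of_real pi) ^ 4) \<le> 1"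
  proof -
    have "1 \<le> (2 * pi) ^ 4" using pi_ge_two by (intro one_le_power) linarith
    thus ?thesis by (simp add: norm_divide norm_power norm_mult)
  qed
  ultimately have "cmod (G4 x t) \<le> 1 * M" unfolding G4_eq norm_mult by (intro mult_mono) auto
  thus ?thesis by (simp add: M_def)
qed

lemma G4_minus: "G4 x (- t) = - G4 x t"
  unfolding G4_def set_lebesgue_integral_def by simp

text \<open>Covers bounded times, where the decay estimate blows up. It rests on |sin (t omega)| <=
  |t| omega.\<close>

lemma G4_small_time: "cmod (G4 x t) \<le> \<bar>t\<bar> * measure lborel torus4"
proof -
  define f where "f \<xi> = indicator torus4 \<xi> *\<^sub>R (exp (\<i> * complex_of_real (pairing x \<xi>)) * complex_of_real (sin (t * omega \<xi>) / omega \<xi>))" for \<xi>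
  have "cmod (f \<xi>) \<le> \<bar>t\<bar> * indicator torus4 \<xi>" for \<xi>
  proof -
    have "\<bar>sin (t * omega \<xi>)\<bar> \<le> \<bar>t\<bar> * omega \<xi>"
      using abs_sin_x_le_abs_x[of "t * omega \<xi>"] omega_nonneg[of \<xi>] by (simp add: abs_mult)
    hence "\<bar>sin (t * omega \<xi>)\<bar> / omega \<xi> \<le> \<bar>t\<bar>"
      using omega_nonneg[of \<xi>] by (cases "omega \<xi> = 0") (auto simp: pos_divide_le_eq)
    thus ?thesis using omega_nonneg[of \<xi>]
      by (cases "\<xi> \<in> torus4") (auto simp: f_def norm_mult norm_divide)
  qed
  moreover have i: "integrable lborel (\<lambda>\<xi>. \<bar>t\<bar> * indicator torus4 \<xi> :: real)"
    using torus4_finite by (intro integrable_mult_right integrable_real_indicator) auto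
  ultimately have "cmod (integral\<^sup>L lborel f) \<le> (LINT \<xi>|lborel. \<bar>t\<bar> * indicator torus4 \<xi>)"
    by (intro order_trans[OF integral_norm_bound] integral_mono_AE) (auto simp: f_def[abs_def] intro!: Bochner_Integration.integrable_bound[OF i])
  also have "\<dots> = \<bar>t\<bar> * measure lborel torus4" by simp
  finally have "cmod (integral\<^sup>L lborel f) \<le> \<bar>t\<bar> * measure lborel torus4" .
  moreover have "cmod (1 / (2 * complex_of_real pi) ^ 4) \<le> 1"
  proof -
    have "1 \<le> (2 * pi) ^ 4" using pi_ge_two by (intro one_le_power) linarith
    thus ?thesis by (simp add: norm_divide norm_power norm_mult)
  qed
  ultimately have "cmod (G4 x t) \<le> 1 * (\<bar>t\<bar> * measure lborel torus4)"
    unfolding G4_def set_lebesgue_integral_def f_def[abs_def] norm_mult by (intro mult_mono) auto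
  thus ?thesis by simp
qed

theorem corollary4p3:
  "\<exists>C::real. C > 0 \<and>
     (\<forall>(x::int ^ 4) (t::real).
        cmod (G4 x t) \<le> C * (1 + \<bar>t\<bar>) powr (- 3 / 2) * ln (2 + \<bar>t\<bar>))"
proof -
  define K where "K = bessel_const / cmod fresnel_const"
  define m where "m = measure lborel torus4"
  \<comment> \<open>Large times need 288 K with 288 = 72 * 4, small times need 8 m, and the summand
    1 makes \<open>C\<close> positive.\<close>
  define C where "C = 512 * K + 8 * m + 1"
  have K: "0 \<le> K" by (simp add: K_def bessel_const_def)
  have m: "0 \<le> m" by (simp add: m_def)
  have main: "cmod (G4 x t) \<le> C * (1 + t) powr (- 3 / 2) * ln (2 + t)" if t: "0 \<le> t" for x t
  proof -
    define W where "W = (1 + t) powr (- 3 / 2)"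
    define l where "l = ln (2 + t)"
    have W0: "0 \<le> W" by (simp add: W_def)
    have Wsq: "W = 1 / sqrt (1 + t) ^ 3"
    proof -
      have "W = inverse ((1 + t) powr (3 / 2))" unfolding W_def using powr_minus[of "1 + t" "3 / 2"] by simp
      also have "(1 + t) powr (3 / 2) = ((1 + t) powr (1 / 2)) ^ 3" using t by (simp add: powr_power)
      finally show ?thesis using t by (simp add: powr_half_sqrt inverse_eq_divide)
    qed
    have l: "1 / 2 \<le> l"
    proof -
      have "1 / 2 \<le> ln (2::real)" using ln2_ge_two_thirds by simp
      also have "\<dots> \<le> l" unfolding l_def using t by simp
      finally show ?thesis .
    qed
    show ?thesis
    proof (cases "1 \<le> t")
      case True
      \<comment> \<open>Hence the logarithm is at most 2 l, and 18 <= 36 l because l >= 1/2; the sum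
        is 72 l.\<close>
      have "1 + 4 * t \<le> (2 + t)\<^sup>2" by (simp add: power2_eq_square algebra_simps)
      hence "ln (1 + 4 * t) \<le> ln ((2 + t)\<^sup>2)" using True by (intro ln_mono) auto
      also have "\<dots> = 2 * l" using True by (simp add: l_def ln_realpow)
      finally have "18 + 18 * ln (1 + 4 * t) \<le> 72 * l" using l by linarith
      moreover have "1 / sqrt t ^ 3 \<le> 4 * W"
      proof -
        have "sqrt (1 + t) \<le> sqrt 2 * sqrt t" using True by (simp add: real_sqrt_mult[symmetric])
        hence "sqrt (1 + t) ^ 3 \<le> (sqrt 2 * sqrt t) ^ 3" using t by (intro power_mono) auto
        also have "\<dots> = sqrt 2 ^ 3 * sqrt t ^ 3" by (simp add: power_mult_distrib)
        also have "\<dots> \<le> 4 * sqrt t ^ 3"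
        proof (rule mult_right_mono)
          have "sqrt 2 ^ 3 = 2 * sqrt 2" by (simp add: eval_nat_numeral)
          moreover have "sqrt 2 \<le> 2" by (rule real_le_lsqrt) auto
          ultimately show "sqrt 2 ^ 3 \<le> 4" by simp
        qed (use True in auto)
        finally show ?thesis unfolding Wsq using True by (simp add: field_simps)
      qed
      ultimately have "K * ((18 + 18 * ln (1 + 4 * t)) * (1 / sqrt t ^ 3)) \<le> K * (72 * l * (4 * W))"
        using K l W0 True by (intro mult_left_mono mult_mono) auto
      moreover have "cmod (G4 x t) \<le> K * ((18 + 18 * ln (1 + 4 * t)) * (1 / sqrt t ^ 3))"
        using G4_large_time[of t x] True by (simp add: K_def)
      moreover have "K * (72 * l * (4 * W)) = 288 * K * (W * l)" by simp
      ultimately have "cmod (G4 x t) \<le> 288 * K * (W * l)" by linarith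
      also have "\<dots> \<le> C * (W * l)" using K m W0 l by (intro mult_right_mono) (auto simp: C_def)
      finally show ?thesis by (simp add: W_def l_def mult.assoc)
    next
      case False
      have "sqrt (1 + t) ^ 3 \<le> 4"
      proof -
        have "sqrt (1 + t) ^ 3 = (1 + t) * sqrt (1 + t)" using t by (simp add: eval_nat_numeral)
        also have "\<dots> \<le> 2 * 2"
        proof (rule mult_mono)
          show "sqrt (1 + t) \<le> 2" by (rule real_le_lsqrt) (use False t in auto)
        qed (use False t in auto)
        finally show ?thesis by simp
      qed
      hence "1 / 4 \<le> W" unfolding Wsq using t by (simp add: field_simps)
      \<comment> \<open>On [0, 1) the claimed profile is at least 1/8, which is where the
        coefficient 8 of \<open>m\<close> comes from.\<close>
      hence "1 / 4 * (1 / 2) \<le> W * l" using l by (intro mult_mono) auto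
      hence "m \<le> 8 * m * (W * l)" using m mult_left_mono[of "1 / 8" "W * l" "8 * m"] by simp
      moreover have "cmod (G4 x t) \<le> m"
        using G4_small_time[of x t] False t m mult_right_mono[of t 1 m] by (simp add: m_def)
      moreover have "8 * m * (W * l) \<le> C * (W * l)" using K W0 l by (intro mult_right_mono) (auto simp: C_def)
      ultimately show ?thesis by (simp add: W_def l_def mult.assoc)
    qed
  qed
  show ?thesis
  proof (intro exI conjI allI)
    show "0 < C" using K m by (simp add: C_def)
    fix x t
    show "cmod (G4 x t) \<le> C * (1 + \<bar>t\<bar>) powr (- 3 / 2) * ln (2 + \<bar>t\<bar>)"
      using main[of "\<bar>t\<bar>" x] G4_minus[of x t] by (cases "0 \<le> t") auto
  qed
qed

end
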